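(* Let $M(t)=\sum_{j=1}^{N(1)}L_j(t-T_j)$, $t\ge 1$, be the Poisson cluster model with a non-homogeneous Poisson process $N$ with mean measure $\Lambda$ and i.i.d. clusters $L_k$ distributed as an $NB(\mu(t),p)$ process $L$, where $\mu(t)>0$ is continuous and $p\in(0,1)$, $q=1-p$ (full setting in the context). Let $t\ge1$, $s>0$, $m\in\{1,2,\ldots\}$. Then the prediction $\widehat M_m(t,t+s]:=E[M(t,t+s]\mid M(t)=m]$ is $$\widehat M_m(t,t+s]=\frac{1}{p\,\big(p^{m-1}G_{R_{N(1)}(t)}(p)\big)^{(m)}_p}\sum_{k=0}^{m-1}\binom{m}{k}\frac{(m-1)!}{(m-k-1)!}(-p^{m-k-1}q)\Big\{(m-k)G^{(m-k,0)}_{t,t+s}(p,1)+p\,G^{(m-k+1,0)}_{t,t+s}(p,1)-G^{(m-k,1)}_{t,t+s}(p,1)\Big\},$$ and the conditional mean squared error is $$\begin{aligned}\mathrm{Var}(M(t,t+s]\mid M(t)=m)={}&-\big(\widehat M_m(t,t+s]\big)^2+\frac{1}{p\,\big(p^{m-1}G_{R_{N(1)}(t)}(p)\big)^{(m)}_p}\sum_{k=0}^{m-1}\binom{m}{k}\frac{(m-1)!}{(m-k-1)!}p^{m-k-2}q\\&\times\Big[(m-k)\{(m-k)q-1\}G^{(m-k,0)}_{t,t+s}(p,1)+p\{2(m-k)q-p\}G^{(m-k+1,0)}_{t,t+s}(p,1)\\&\quad-\{2(m-k)q-1-q\}G^{(m-k,1)}_{t,t+s}(p,1)\\&\quad+q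\big\{p^2G^{(m-k+2,0)}_{t,t+s}(p,1)-2p\,G^{(m-k+1,1)}_{t,t+s}(p,1)+G^{(m-k,2)}_{t,t+s}(p,1)\big\}\Big].\end{aligned}$$
   Context: Model: $0<T_1<T_2<\cdots$ are the points of a non-homogeneous Poisson process $N$ on $[0,\infty)$ with locally finite mean measure $\Lambda$; $\Lambda(1):=\Lambda[0,1]\in(0,\infty)$ and $N(1)=\#\{j:T_j\le1\}$. The $L_j$ are i.i.d. copies of a process $L$, $L_j(t)=0$ a.s. for $t\le0$, and $(T_j)$, $(L_j)$ are independent. $M(t,t+s]=M(t+s)-M(t)$. $NB(\mu(t),p)$ process: $\mu$ is a continuous nondecreasing function with $\mu(0)=0$ and $\mu(t)>0$ for $t>0$; $L$ has independent increments, $L(0)=0$, and $E[\mathrm{e}^{ixL(t)}]=\big(p/(1-q\mathrm{e}^{ix})\big)^{\mu(t)}$, i.e. $P(L(t)=k)=\binom{\mu(t)+k-1}{k}p^{\mu(t)}q^k$, $k=0,1,2,\ldots$; the increment $L(t)-L(s)$, $s\le t$, is $NB(\mu(t)-\mu(s),p)$. Random sum: $R_{N(1)}(t)=\sum_{j=1}^{N(1)}\mu(t-V_j)$, $t\ge1$, with $(V_j)$ i.i.d. with distribution $\Lambda(\mathrm{d}x)/\Lambda(1)$ on $[0,1]$, independent of $N$. Generating functions: $G_{R_{N(1)}(t)}(z)=E[z^{R_{N(1)}(t)}]$ and $G_{t,t+s}(z_1,z_2)=E[z_1^{R_{N(1)}(t)}z_2^{R_{N(1)}(t+s)}]$ for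 $z,z_1,z_2>0$; $G^{(k,\ell)}_{t,t+s}$ is the partial derivative of order $k$ in $z_1$ and $\ell$ in $z_2$. $(\cdot)^{(m)}_p$ denotes the $m$-th derivative with respect to $p$ of the expression in the bracket (the function $G_{R_{N(1)}(t)}$ itself does not depend on $p$).
   Formalization: The clusters L_j are assumed to have right-continuous sample paths; without path regularity the claim fails, since replacing L_j(u) by L_j(u)+1{u=t−T_j} keeps all finite-dimensional laws and independence but changes M(t) to M(t)+N(1). *)

theory Defs
  imports "HOL-Probability.Probability"
begin

text \<open>
  The point sequence is indexed from 0, so \<open>T j\<close> is the point usually called $T_{j+1}$. It is
  valued in the extended reals because a mean measure of finite total mass produces only
  finitely many points; the absent ones sit at \<open>\<infinity>\<close>.
\<close>

definition point_sequence :: "'a measure \<Rightarrow> (nat \<Rightarrow> 'a \<Rightarrow> ereal) \<Rightarrow> bool" where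
  "point_sequence M T \<longleftrightarrow>
     (\<forall>j. T j \<in> borel_measurable M) \<and>
     (AE \<omega> in M. 0 < T 0 \<omega>) \<and>
     (AE \<omega> in M. \<forall>j. (T j \<omega> \<noteq> \<infinity> \<longrightarrow> T j \<omega> < T (Suc j) \<omega>) \<and> (T j \<omega> = \<infinity> \<longrightarrow> T (Suc j) \<omega> = \<infinity>)) \<and>
     (AE \<omega> in M. \<forall>x::real. finite {j. T j \<omega> \<le> ereal x})"

definition num_points :: "(nat \<Rightarrow> 'a \<Rightarrow> ereal) \<Rightarrow> real set \<Rightarrow> 'a \<Rightarrow> nat" where
  "num_points T B \<omega> = card {j. T j \<omega> \<in> ereal ` B}"

definition locally_finite_measure :: "real measure \<Rightarrow> bool" where
  "locally_finite_measure \<Lambda> \<longleftrightarrow>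
     sets \<Lambda> = sets borel \<and> emeasure \<Lambda> {..<0} = 0 \<and> (\<forall>x\<ge>0. emeasure \<Lambda> {0..x} < \<infinity>)"

text \<open>
  The Poisson law is written out because the library's \<open>poisson_pmf\<close> does not cover rate 0,
  which occurs here for null sets of \<open>\<Lambda>\<close>.
\<close>

definition poisson_process :: "'a measure \<Rightarrow> real measure \<Rightarrow> (nat \<Rightarrow> 'a \<Rightarrow> ereal) \<Rightarrow> bool" where
  "poisson_process M \<Lambda> T \<longleftrightarrow>
     point_sequence M T \<and>
     (\<forall>B. B \<in> sets borel \<and> bounded B \<and> B \<subseteq> {0..} \<longrightarrow>
        (\<forall>k. measure M {\<omega> \<in> space M. num_points T B \<omega> = k} =
              exp (- measure \<Lambda> B) * measure \<Lambda> B ^ k / fact k)) \<and>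
     (\<forall>(n::nat) B. (\<forall>i<n. B i \<in> sets borel \<and> bounded (B i) \<and> B i \<subseteq> {0..}) \<and>
        disjoint_family_on B {..<n} \<longrightarrow>
        prob_space.indep_vars M (\<lambda>_. count_space UNIV) (\<lambda>i. num_points T (B i)) {..<n})"

text \<open>The law $NB(r,p)$ for real $r \ge 0$; at $r = 0$ it is the point mass at 0.\<close>

definition has_NB_law :: "'a measure \<Rightarrow> ('a \<Rightarrow> real) \<Rightarrow> real \<Rightarrow> real \<Rightarrow> bool" where
  "has_NB_law M X r p \<longleftrightarrow>
     X \<in> borel_measurable M \<and>
     (\<forall>k::nat. measure M {\<omega> \<in> space M. X \<omega> = real k} =
        ((r + real k - 1) gchoose k) * p powr r * (1 - p) ^ k)"

text \<open>
  Right-continuity of the sample paths is the usual regularity of a cluster process. Without path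
  regularity, \<open>L (t - T j)\<close> at a random time is not determined by the finite-dimensional
  distributions: changing \<open>L\<close> at the single random time \<open>t - T j\<close> does not affect them.
  Left limits need not be required, as the increments are almost surely nonnegative.
  The law at a single time \<open>t \<ge> 0\<close> is the increment clause with \<open>s = 0\<close>.
\<close>

definition NB_process :: "'a measure \<Rightarrow> (real \<Rightarrow> real) \<Rightarrow> real \<Rightarrow> (real \<Rightarrow> 'a \<Rightarrow> real) \<Rightarrow> bool" where
  "NB_process M \<mu> p L \<longleftrightarrow>
     (\<forall>t. L t \<in> borel_measurable M) \<and>
     (\<forall>t\<le>0. AE \<omega> in M. L t \<omega> = 0) \<and>
     (\<forall>\<omega>\<in>space M. \<forall>t. continuous (at_right t) (\<lambda>u. L u \<omega>)) \<and>
     (\<forall>(n::nat) u. 0 \<le> u 0 \<and> mono u \<longrightarrow>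
        prob_space.indep_vars M (\<lambda>_. borel) (\<lambda>i \<omega>. L (u (Suc i)) \<omega> - L (u i) \<omega>) {..<n}) \<and>
     (\<forall>s t. 0 \<le> s \<and> s \<le> t \<longrightarrow> has_NB_law M (\<lambda>\<omega>. L t \<omega> - L s \<omega>) (\<mu> t - \<mu> s) p)"

text \<open>
  Identical distribution of the clusters is automatic: the finite-dimensional distributions of an
  NB process are determined by \<open>\<mu>\<close> and \<open>p\<close>.
\<close>

definition iid_NB_clusters ::
    "'a measure \<Rightarrow> (real \<Rightarrow> real) \<Rightarrow> real \<Rightarrow> (nat \<Rightarrow> real \<Rightarrow> 'a \<Rightarrow> real) \<Rightarrow> bool" where
  "iid_NB_clusters M \<mu> p L \<longleftrightarrow>
     (\<forall>j. NB_process M \<mu> p (L j)) \<and>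
     prob_space.indep_vars M (\<lambda>_. PiM UNIV (\<lambda>_. borel)) (\<lambda>j \<omega> t. L j t \<omega>) UNIV"

text \<open>The library's \<open>indep_var\<close> needs both random elements to have the same value type.\<close>

definition indep_elements ::
    "'a measure \<Rightarrow> 'b measure \<Rightarrow> ('a \<Rightarrow> 'b) \<Rightarrow> 'c measure \<Rightarrow> ('a \<Rightarrow> 'c) \<Rightarrow> bool" where
  "indep_elements M S X S' Y \<longleftrightarrow>
     X \<in> measurable M S \<and> Y \<in> measurable M S' \<and>
     prob_space.indep_set M
       {X -` B \<inter> space M | B. B \<in> sets S} {Y -` B \<inter> space M | B. B \<in> sets S'}"

definition cluster_model ::
    "(nat \<Rightarrow> 'a \<Rightarrow> ereal) \<Rightarrow> (nat \<Rightarrow> real \<Rightarrow> 'a \<Rightarrow> real) \<Rightarrow> real \<Rightarrow> 'a \<Rightarrow> real" where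
  "cluster_model T L t \<omega> = (\<Sum>j<num_points T {0..1} \<omega>. L j (t - real_of_ereal (T j \<omega>)) \<omega>)"

definition iid_normalized :: "'a measure \<Rightarrow> real measure \<Rightarrow> (nat \<Rightarrow> 'a \<Rightarrow> real) \<Rightarrow> bool" where
  "iid_normalized M \<Lambda> V \<longleftrightarrow>
     (\<forall>j. \<forall>\<omega>\<in>space M. V j \<omega> \<in> {0..1}) \<and>
     prob_space.indep_vars M (\<lambda>_. borel) V UNIV \<and>
     (\<forall>j. \<forall>A\<in>sets borel.
        measure M {\<omega> \<in> space M. V j \<omega> \<in> A} = measure \<Lambda> (A \<inter> {0..1}) / measure \<Lambda> {0..1})"

definition random_sum ::
    "(real \<Rightarrow> real) \<Rightarrow> (nat \<Rightarrow> 'a \<Rightarrow> ereal) \<Rightarrow> (nat \<Rightarrow> 'a \<Rightarrow> real) \<Rightarrow> real \<Rightarrow> 'a \<Rightarrow> real" where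
  "random_sum \<mu> T V t \<omega> = (\<Sum>j<num_points T {0..1} \<omega>. \<mu> (t - V j \<omega>))"

definition gen_fun :: "'a measure \<Rightarrow> ('a \<Rightarrow> real) \<Rightarrow> real \<Rightarrow> real" where
  "gen_fun M X z = (LINT \<omega>|M. z powr X \<omega>)"

definition gen_fun2 :: "'a measure \<Rightarrow> ('a \<Rightarrow> real) \<Rightarrow> ('a \<Rightarrow> real) \<Rightarrow> real \<Rightarrow> real \<Rightarrow> real" where
  "gen_fun2 M X Y z\<^sub>1 z\<^sub>2 = (LINT \<omega>|M. z\<^sub>1 powr X \<omega> * z\<^sub>2 powr Y \<omega>)"

definition partial_deriv ::
    "nat \<Rightarrow> nat \<Rightarrow> (real \<Rightarrow> real \<Rightarrow> real) \<Rightarrow> real \<Rightarrow> real \<Rightarrow> real" where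
  "partial_deriv k l G z\<^sub>1 z\<^sub>2 = (deriv ^^ k) (\<lambda>x. (deriv ^^ l) (\<lambda>y. G x y) z\<^sub>2) z\<^sub>1"

definition cond_expectation_on :: "'a measure \<Rightarrow> ('a \<Rightarrow> real) \<Rightarrow> 'a set \<Rightarrow> real" where
  "cond_expectation_on M X A = (LINT \<omega>|uniform_measure M A. X \<omega>)"

definition cond_variance_on :: "'a measure \<Rightarrow> ('a \<Rightarrow> real) \<Rightarrow> 'a set \<Rightarrow> real" where
  "cond_variance_on M X A =
     (LINT \<omega>|uniform_measure M A. (X \<omega> - cond_expectation_on M X A)\<^sup>2)"

end

theory Submission
  imports Defs
begin

text \<open>
  Given the Poisson points, \<open>M t\<close> and the increment \<open>M (t + s) - M t\<close> are sums over the clusters of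
  independent negative binomial variables with the same \<open>p\<close>. Hence they are again independent
  negative binomial, with the random parameters \<open>\<Sum>j. \<mu> (t - T j)\<close> and
  \<open>\<Sum>j. (\<mu> (t + s - T j) - \<mu> (t - T j))\<close>; by the order statistics property these have the joint law of
  \<open>X = R t\<close> and \<open>Y - X = R (t + s) - R t\<close>. So the probability of \<open>M t = m\<close> and the first two moments of
  the increment on this event are expectations of
  \<open>pochhammer X m / fact m * p powr X * q ^ m\<close> times, respectively, \<open>1\<close>, the mean
  \<open>(Y - X) * (q / p)\<close> and the second moment \<open>q / p\<^sup>2 * ((Y - X) + q * (Y - X)\<^sup>2)\<close>.

  Derivatives of the generating functions produce falling factorials of \<open>X\<close> and \<open>Y\<close> under the
  expectation (lemma \<open>partial_deriv_gen_fun2\<close>; differentiation under the integral is legitimate as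
  the Poisson number of points has all exponential moments). The rising factorial
  \<open>pochhammer X m\<close> is a combination of falling factorials with Lah numbers as coefficients (lemma
  \<open>pochhammer_eq_sum_falling_factorial\<close>), which are the coefficients in the formulas, and the
  brackets recombine to the moments of the increment (lemmas \<open>bracket_mean\<close> and
  \<open>bracket_second_moment\<close>).

  The probabilistic part is done on the level of generating functions. The clusters are
  evaluated at the random times \<open>t - T j\<close>, so the points are first moved to a grid from the left.
  For the discretised sums the conditioning is elementary, the counts in the cells of the grid are
  independent Poisson variables, and right-continuity of the paths allows passage to the limit.
  This gives \<open>E (x powr M t * y powr (M (t + s) - M t)) = E (a powr X * b powr (Y - X))\<close> with
  \<open>a = p / (1 - q * x)\<close> and \<open>b = p / (1 - q * y)\<close> (lemma \<open>cluster_model_joint_pgf\<close>). Both sides are power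
  series in \<open>x\<close> and \<open>y\<close>, the right one by the negative binomial series, and comparing
  coefficients yields the joint law (lemma \<open>cluster_model_joint_law\<close>).
\<close>

section \<open>The negative binomial law\<close>

definition nb_mass :: "real \<Rightarrow> real \<Rightarrow> nat \<Rightarrow> real" where
  "nb_mass p r k = ((r + real k - 1) gchoose k) * p powr r * (1 - p) ^ k"

lemma nb_mass_pochhammer:
  "nb_mass p r k = pochhammer r k / fact k * p powr r * (1 - p) ^ k"
  by (simp add: nb_mass_def gbinomial_pochhammer')

lemma nb_mass_nonneg: "0 \<le> r \<Longrightarrow> p \<le> 1 \<Longrightarrow> 0 \<le> nb_mass p r k"
  unfolding nb_mass_pochhammer pochhammer_prod
  by (intro mult_nonneg_nonneg divide_nonneg_nonneg prod_nonneg) auto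

text \<open>
  The negative binomial series: \<open>pochhammer r k / fact k\<close> is the coefficient of \<open>z ^ k\<close>
  in \<open>(1 - z) powr - r\<close>.
\<close>

lemma nb_mass_pgf:
  assumes "0 < p" "p < 1" "0 \<le> x" "x \<le> 1"
  shows "(\<lambda>k. nb_mass p r k * x ^ k) sums ((p / (1 - (1 - p) * x)) powr r)"
proof -
  define z where "z = (1 - p) * x"
  have "z \<le> 1 - p"
    unfolding z_def using assms by (intro mult_left_le) auto
  moreover have "0 \<le> z"
    using assms by (simp add: z_def)
  ultimately have z: "0 \<le> z" "z < 1"
    using assms by linarith+
  have "(\<lambda>k. ((- r) gchoose k) * (- z) ^ k) sums (1 + - z) powr - r"
    using z by (intro gen_binomial_real) simp
  then have "(\<lambda>k. p powr r * (((- r) gchoose k) * (- z) ^ k)) sums (p powr r * (1 + - z) powr - r)"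
    by (rule sums_mult)
  moreover have "p powr r * (((- r) gchoose k) * (- z) ^ k) = nb_mass p r k * x ^ k" for k
  proof -
    have "((- r) gchoose k) * (- z) ^ k = pochhammer r k / fact k * z ^ k"
      unfolding power_minus[of z] gbinomial_pochhammer by simp
    then show ?thesis
      unfolding nb_mass_pochhammer z_def by (simp add: power_mult_distrib mult_ac)
  qed
  moreover have "p powr r * (1 + - z) powr - r = (p / (1 - (1 - p) * x)) powr r"
    using assms z by (simp add: powr_minus powr_divide z_def divide_simps)
  ultimately show ?thesis by simp
qed

lemma nb_mass_sums_1: "0 < p \<Longrightarrow> p < 1 \<Longrightarrow> (nb_mass p r) sums 1"
  using nb_mass_pgf[of p 1 r] by simp

text \<open>
  Multiplication by \<open>k\<close> shifts the parameter by one; hence the factorial moments of the law are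
  read off from its total mass.
\<close>

lemma nb_mass_Suc:
  assumes "0 < p"
  shows "real (Suc k) * nb_mass p r (Suc k) = r * ((1 - p) / p) * nb_mass p (r + 1) k"
proof -
  have "real (Suc k) * (y / fact (Suc k)) = y / fact k" for y :: real
    by (simp del: of_nat_Suc)
  then have "real (Suc k) * nb_mass p r (Suc k)
      = pochhammer r (Suc k) / fact k * (p powr r * (1 - p) ^ Suc k)"
    unfolding nb_mass_pochhammer by (metis mult.assoc)
  also have "\<dots> = r * ((1 - p) / p) * nb_mass p (r + 1) k"
    using assms by (simp add: nb_mass_pochhammer pochhammer_rec powr_add)
  finally show ?thesis .
qed

lemma nb_mass_mean:
  assumes "0 < p" "p < 1"
  shows "(\<lambda>k. real k * nb_mass p r k) sums (r * ((1 - p) / p))"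
proof -
  have "(\<lambda>k. real (Suc k) * nb_mass p r (Suc k)) sums (r * ((1 - p) / p) * 1)"
    unfolding nb_mass_Suc[OF assms(1)] by (intro sums_mult nb_mass_sums_1 assms)
  then show ?thesis
    by (subst (asm) sums_Suc_iff) simp
qed

lemma nb_mass_second_moment:
  assumes "0 < p" "p < 1"
  shows "(\<lambda>k. (real k)\<^sup>2 * nb_mass p r k) sums ((1 - p) / p\<^sup>2 * (r + (1 - p) * r\<^sup>2))"
proof -
  have "(\<lambda>k. r * ((1 - p) / p) * (real k * nb_mass p (r + 1) k + nb_mass p (r + 1) k))
      sums (r * ((1 - p) / p) * ((r + 1) * ((1 - p) / p) + 1))"
    by (intro sums_mult sums_add nb_mass_mean nb_mass_sums_1 assms)
  also have "(\<lambda>k. r * ((1 - p) / p) * (real k * nb_mass p (r + 1) k + nb_mass p (r + 1) k))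
      = (\<lambda>k. (real (Suc k))\<^sup>2 * nb_mass p r (Suc k))"
  proof
    fix k
    have "(real (Suc k))\<^sup>2 * nb_mass p r (Suc k)
        = real (Suc k) * (real (Suc k) * nb_mass p r (Suc k))"
      by (simp only: power2_eq_square mult.assoc)
    then show "r * ((1 - p) / p) * (real k * nb_mass p (r + 1) k + nb_mass p (r + 1) k)
        = (real (Suc k))\<^sup>2 * nb_mass p r (Suc k)"
      unfolding nb_mass_Suc[OF assms(1)] by (simp add: distrib_left distrib_right mult_ac add_divide_distrib)
  qed
  also have "r * ((1 - p) / p) * ((r + 1) * ((1 - p) / p) + 1)
      = (1 - p) / p\<^sup>2 * (r + (1 - p) * r\<^sup>2)"
    using assms by (simp add: field_simps power2_eq_square)
  finally show ?thesis
    by (subst (asm) sums_Suc_iff) simp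
qed

section \<open>Factorial powers and power series\<close>

definition falling_factorial :: "real \<Rightarrow> nat \<Rightarrow> real" where
  "falling_factorial x k = (\<Prod>i<k. x - real i)"

lemma falling_factorial_0 [simp]: "falling_factorial x 0 = 1"
  by (simp add: falling_factorial_def)

lemma falling_factorial_Suc: "falling_factorial x (Suc k) = falling_factorial x k * (x - real k)"
  by (simp add: falling_factorial_def)

lemma falling_factorial_1: "falling_factorial x (Suc 0) = x"
  by (simp add: falling_factorial_Suc)

lemma falling_factorial_2: "falling_factorial x 2 = x * (x - 1)"
  by (simp add: numeral_2_eq_2 falling_factorial_Suc)

lemma falling_factorial_gbinomial: "falling_factorial x k = fact k * (x gchoose k)"
  by (simp add: falling_factorial_def gbinomial_prod_rev atLeast0LessThan)

lemma pochhammer_eq_falling_factorial: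
  "m \<ge> 1 \<Longrightarrow> falling_factorial (x + real (m - 1)) m = pochhammer x m"
  unfolding falling_factorial_gbinomial gbinomial_pochhammer' by (simp add: of_nat_diff)

text \<open>
  The coefficients are the Lah numbers; after division by \<open>fact m\<close> the identity is
  Vandermonde's for \<open>x + (m - 1)\<close>.
\<close>

lemma pochhammer_eq_sum_falling_factorial:
  assumes "m \<ge> 1"
  shows "pochhammer x m
    = (\<Sum>k=0..m-1. real (m choose k) * (fact (m - 1) / fact (m - k - 1)) * falling_factorial x (m - k))"
proof -
  have "(x + real (m - 1)) gchoose m = (\<Sum>k\<le>m. (x gchoose (m - k)) * (real (m - 1) gchoose k))"
    using gbinomial_Vandermonde[of "real (m - 1)" x m] by (simp add: add.commute mult.commute atMost_atLeast0)
  also have "\<dots> = (\<Sum>k=0..m-1. (x gchoose (m - k)) * (real (m - 1) gchoose k))"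
  proof -
    have "{..m} = insert m {0..m-1}" using assms by auto
    moreover have "real (m - 1) gchoose m = 0"
      using assms by (simp only: flip: binomial_gbinomial) (simp add: binomial_eq_0)
    ultimately show ?thesis using assms by (simp del: of_nat_diff)
  qed
  finally have "pochhammer x m
      = (\<Sum>k=0..m-1. fact m * ((x gchoose (m - k)) * (real (m - 1) gchoose k)))"
    using pochhammer_eq_falling_factorial[OF assms, of x]
    by (simp add: falling_factorial_gbinomial sum_distrib_left)
  also have "\<dots> = (\<Sum>k=0..m-1. real (m choose k) * (fact (m - 1) / fact (m - k - 1)) * falling_factorial x (m - k))"
  proof (rule sum.cong[OF refl])
    fix k assume k: "k \<in> {0..m-1}"
    have 1: "real (m choose k) = fact m / (fact k * fact (m - k))"
      using k assms by (intro binomial_fact) auto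
    have 2: "real (m - 1) gchoose k = fact (m - 1) / (fact k * fact (m - k - 1))"
      using k assms by (subst binomial_gbinomial[symmetric], subst binomial_fact)
        (auto simp: diff_commute)
    show "fact m * ((x gchoose (m - k)) * (real (m - 1) gchoose k))
        = real (m choose k) * (fact (m - 1) / fact (m - k - 1)) * falling_factorial x (m - k)"
      unfolding 1 2 falling_factorial_gbinomial by simp
  qed
  finally show ?thesis .
qed

text \<open>
  Bounded coefficients make both series converge on \<open>(-1, 1)\<close>, so the constant terms
  can be read off as limits at \<open>0\<close> even though equality is given on one side only.
\<close>

lemma power_series_eq_imp_coeff_eq:
  fixes c d :: "nat \<Rightarrow> real"
  assumes "\<And>x. 0 < x \<Longrightarrow> x < 1 \<Longrightarrow> \<exists>y. (\<lambda>n. c n * x ^ n) sums y \<and> (\<lambda>n. d n * x ^ n) sums y"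
    and "bounded (range c)" "bounded (range d)"
  shows "c n = d n"
proof -
  have const: "e 0 = 0"
    if sums_0: "\<And>x. 0 < x \<Longrightarrow> x < 1 \<Longrightarrow> (\<lambda>n. e n * x ^ n) sums 0"
      and K: "\<And>n. \<bar>e n\<bar> \<le> K" for e :: "nat \<Rightarrow> real" and K
  proof -
    have sm: "summable (\<lambda>n. e n * x ^ n)" if "norm x < 1" for x
    proof (rule summable_comparison_test)
      show "summable (\<lambda>n. K * \<bar>x\<bar> ^ n)"
        using that by (intro summable_mult summable_geometric) auto
      show "\<exists>N. \<forall>n\<ge>N. norm (e n * x ^ n) \<le> K * \<bar>x\<bar> ^ n"
        using K by (auto simp: abs_mult power_abs intro!: mult_right_mono)
    qed
    have "((\<lambda>x. \<Sum>n. e n * x ^ n) \<longlongrightarrow> e 0) (at 0)"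
      by (rule powser_limit_0_strong[of 1]) (simp_all add: summable_sums[OF sm])
    then have "((\<lambda>x. \<Sum>n. e n * x ^ n) \<longlongrightarrow> e 0) (at_right 0)"
      by (simp add: filterlim_at_split)
    moreover have "\<forall>\<^sub>F x in at_right 0. (\<Sum>n. e n * x ^ n) = 0"
      using sums_0 by (auto simp: eventually_at_right_field sums_iff intro!: exI[of _ 1])
    ultimately have "((\<lambda>x. 0) \<longlongrightarrow> e 0) (at_right (0::real))"
      by (rule Lim_transform_eventually)
    then show ?thesis
      by (simp add: tendsto_const_iff)
  qed
  have zero: "e n = 0"
    if "\<And>x. 0 < x \<Longrightarrow> x < 1 \<Longrightarrow> (\<lambda>n. e n * x ^ n) sums 0" "\<And>n. \<bar>e n\<bar> \<le> K"
    for e :: "nat \<Rightarrow> real" and n K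
    using that
  proof (induction n arbitrary: e)
    case 0
    then show ?case by (rule const)
  next
    case (Suc n)
    have "(\<lambda>n. e (Suc n) * x ^ n) sums 0" if x: "0 < x" "x < 1" for x
    proof -
      have "(\<lambda>n. e (Suc n) * x ^ Suc n) sums 0"
        using Suc.prems(1)[OF x] const[OF Suc.prems] by (subst sums_Suc_iff) simp
      from sums_divide[OF this, of x] show ?thesis using x by simp
    qed
    with Suc.prems(2) show ?case by (intro Suc.IH) auto
  qed
  obtain K K' where K: "\<And>n. \<bar>c n\<bar> \<le> K" "\<And>n. \<bar>d n\<bar> \<le> K'"
    using assms(2,3) by (auto simp: bounded_iff)
  have "c n - d n = 0"
  proof (rule zero)
    show "(\<lambda>n. (c n - d n) * x ^ n) sums 0" if "0 < x" "x < 1" for x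
      using assms(1)[OF that] sums_diff by (fastforce simp: left_diff_distrib)
    have "\<bar>c n - d n\<bar> \<le> K + K'" for n
      using K[of n] by linarith
    then show "\<bar>c n - d n\<bar> \<le> K + K'" for n .
  qed
  then show ?thesis by simp
qed

section \<open>Derivatives of generating functions\<close>

text \<open>
  By the mean value theorem \<open>w\<close> dominates the difference quotients, so dominated convergence
  applies to them.
\<close>

lemma has_real_derivative_integral:
  fixes f f' :: "real \<Rightarrow> 'a \<Rightarrow> real"
  assumes z: "a < z" "z < b"
    and int: "\<And>y. a < y \<Longrightarrow> y < b \<Longrightarrow> integrable M (f y)"
    and der: "\<And>y \<omega>. \<omega> \<in> space M \<Longrightarrow> a < y \<Longrightarrow> y < b \<Longrightarrow>
      ((\<lambda>y. f y \<omega>) has_real_derivative f' y \<omega>) (at y)"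
    and bound: "\<And>y \<omega>. \<omega> \<in> space M \<Longrightarrow> a < y \<Longrightarrow> y < b \<Longrightarrow> \<bar>f' y \<omega>\<bar> \<le> w \<omega>"
    and w: "integrable M w" and meas: "f' z \<in> borel_measurable M"
  shows "((\<lambda>y. LINT \<omega>|M. f y \<omega>) has_real_derivative (LINT \<omega>|M. f' z \<omega>)) (at z)"
  unfolding has_field_derivative_iff tendsto_at_iff_sequentially
proof (intro allI impI)
  fix Y :: "nat \<Rightarrow> real"
  assume Y: "\<forall>i. Y i \<in> UNIV - {z}" "Y \<longlonglongrightarrow> z"
  have "\<forall>\<^sub>F i in sequentially. a < Y i \<and> Y i < b"
    using order_tendstoD[OF Y(2)] z by (auto intro: eventually_conj)
  then obtain k where k: "\<And>i. a < Y (i + k) \<and> Y (i + k) < b"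
    unfolding eventually_sequentially by (meson le_add2)
  define X where "X i = Y (i + k)" for i
  have X: "a < X i" "X i < b" "X i \<noteq> z" for i
    using k Y(1) by (auto simp: X_def)
  have X_lim: "X \<longlonglongrightarrow> z"
    unfolding X_def using Y(2) by (rule LIMSEQ_ignore_initial_segment)
  have "(\<lambda>i. LINT \<omega>|M. (f (X i) \<omega> - f z \<omega>) / (X i - z)) \<longlonglongrightarrow> (LINT \<omega>|M. f' z \<omega>)"
  proof (rule integral_dominated_convergence[where w = w])
    show "(\<lambda>\<omega>. (f (X i) \<omega> - f z \<omega>) / (X i - z)) \<in> borel_measurable M" for i
      using int[OF X(1,2)] int[OF z] by (intro borel_measurable_integrable) auto
    show "AE \<omega> in M. (\<lambda>i. (f (X i) \<omega> - f z \<omega>) / (X i - z)) \<longlonglongrightarrow> f' z \<omega>"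
    proof (rule AE_I2)
      fix \<omega> assume "\<omega> \<in> space M"
      from der[OF this z] show "(\<lambda>i. (f (X i) \<omega> - f z \<omega>) / (X i - z)) \<longlonglongrightarrow> f' z \<omega>"
        unfolding has_field_derivative_iff tendsto_at_iff_sequentially
        using X X_lim by (auto simp: comp_def)
    qed
    show "AE \<omega> in M. norm ((f (X i) \<omega> - f z \<omega>) / (X i - z)) \<le> w \<omega>" for i
    proof (rule AE_I2)
      fix \<omega> assume \<omega>: "\<omega> \<in> space M"
      have "norm (f (X i) \<omega> - f z \<omega>) \<le> w \<omega> * norm (X i - z)"
        by (rule field_differentiable_bound[where S = "{a<..<b}" and f' = "\<lambda>y. f' y \<omega>"])
          (use \<omega> X z der bound in \<open>auto intro: has_field_derivative_at_within\<close>)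
      then show "norm ((f (X i) \<omega> - f z \<omega>) / (X i - z)) \<le> w \<omega>"
        using X(3)[of i] by (simp add: divide_simps)
    qed
  qed (use w meas in auto)
  then have "(\<lambda>i. ((LINT \<omega>|M. f (X i) \<omega>) - (LINT \<omega>|M. f z \<omega>)) / (X i - z)) \<longlonglongrightarrow> (LINT \<omega>|M. f' z \<omega>)"
    using int[OF X(1,2)] int[OF z] by simp
  then show "((\<lambda>y. ((LINT \<omega>|M. f y \<omega>) - (LINT \<omega>|M. f z \<omega>)) / (y - z)) \<circ> Y) \<longlonglongrightarrow> (LINT \<omega>|M. f' z \<omega>)"
    unfolding comp_def X_def by (rule LIMSEQ_offset)
qed

text \<open>
  \<open>K\<close> will be the Poisson number of points, all of whose exponential moments are finite. The
  class of functions of growth at most exponential in \<open>K\<close> is closed under products, so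
  integrability and domination reduce to bounding each factor.
\<close>

definition exp_dominated :: "'a measure \<Rightarrow> ('a \<Rightarrow> real) \<Rightarrow> ('a \<Rightarrow> real) \<Rightarrow> bool" where
  "exp_dominated M K W \<longleftrightarrow> W \<in> borel_measurable M \<and>
     (\<exists>C r. \<forall>\<omega>\<in>space M. \<bar>W \<omega>\<bar> \<le> C * exp (r * K \<omega>))"

lemma exp_dominated_measurable: "exp_dominated M K W \<Longrightarrow> W \<in> borel_measurable M"
  by (simp add: exp_dominated_def)

lemma exp_dominated_integrable:
  assumes "exp_dominated M K W" "\<And>r. integrable M (\<lambda>\<omega>. exp (r * K \<omega>))"
  shows "integrable M W"
proof -
  obtain C r where C: "\<And>\<omega>. \<omega> \<in> space M \<Longrightarrow> \<bar>W \<omega>\<bar> \<le> C * exp (r * K \<omega>)"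
    using assms(1) by (auto simp: exp_dominated_def)
  show ?thesis
    by (rule Bochner_Integration.integrable_bound[where f = "\<lambda>\<omega>. C * exp (r * K \<omega>)"])
      (use assms C in \<open>auto simp: exp_dominated_def intro!: AE_I2 order_trans[OF C]\<close>)
qed

lemma exp_dominated_const: "exp_dominated M K (\<lambda>\<omega>. c)"
  unfolding exp_dominated_def
  by (intro conjI exI[of _ "\<bar>c\<bar>"] exI[of _ 0]) simp_all

lemma exp_dominated_mult:
  assumes "exp_dominated M K W" "exp_dominated M K W'"
  shows "exp_dominated M K (\<lambda>\<omega>. W \<omega> * W' \<omega>)"
proof -
  obtain C r C' r' where C: "\<And>\<omega>. \<omega> \<in> space M \<Longrightarrow> \<bar>W \<omega>\<bar> \<le> C * exp (r * K \<omega>)"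
      "\<And>\<omega>. \<omega> \<in> space M \<Longrightarrow> \<bar>W' \<omega>\<bar> \<le> C' * exp (r' * K \<omega>)"
    using assms unfolding exp_dominated_def by blast
  have "\<bar>W \<omega> * W' \<omega>\<bar> \<le> (C * C') * exp ((r + r') * K \<omega>)" if "\<omega> \<in> space M" for \<omega>
  proof -
    have "\<bar>W \<omega>\<bar> * \<bar>W' \<omega>\<bar> \<le> (C * exp (r * K \<omega>)) * (C' * exp (r' * K \<omega>))"
      using C[OF that] by (intro mult_mono) (auto intro: order_trans[OF abs_ge_zero])
    then show ?thesis
      by (simp add: abs_mult distrib_right exp_add) (simp add: mult_ac)
  qed
  moreover have "(\<lambda>\<omega>. W \<omega> * W' \<omega>) \<in> borel_measurable M"
    using assms[THEN exp_dominated_measurable] by measurable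
  ultimately show ?thesis
    unfolding exp_dominated_def by blast
qed

lemma exp_dominated_exp_abs:
  assumes "X \<in> borel_measurable M" "0 \<le> r"
    and "\<And>\<omega>. \<omega> \<in> space M \<Longrightarrow> \<bar>X \<omega>\<bar> \<le> c + d * K \<omega>"
  shows "exp_dominated M K (\<lambda>\<omega>. exp (r * \<bar>X \<omega>\<bar>))"
  unfolding exp_dominated_def
proof (intro conjI exI ballI)
  fix \<omega> assume "\<omega> \<in> space M"
  then have "r * \<bar>X \<omega>\<bar> \<le> r * (c + d * K \<omega>)"
    using assms by (intro mult_left_mono) auto
  then show "\<bar>exp (r * \<bar>X \<omega>\<bar>)\<bar> \<le> exp (r * c) * exp (r * d * K \<omega>)"
    by (simp add: algebra_simps flip: exp_add)
qed (use assms in simp)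

lemma exp_dominated_bound:
  assumes "exp_dominated M K W'" "W \<in> borel_measurable M"
    and "\<And>\<omega>. \<omega> \<in> space M \<Longrightarrow> \<bar>W \<omega>\<bar> \<le> C * W' \<omega>" "0 \<le> C"
  shows "exp_dominated M K W"
proof -
  obtain D r where D: "\<And>\<omega>. \<omega> \<in> space M \<Longrightarrow> \<bar>W' \<omega>\<bar> \<le> D * exp (r * K \<omega>)"
    using assms(1) by (auto simp: exp_dominated_def)
  have "\<bar>W \<omega>\<bar> \<le> (C * D) * exp (r * K \<omega>)" if "\<omega> \<in> space M" for \<omega>
  proof -
    have "W' \<omega> \<le> D * exp (r * K \<omega>)" using D[OF that] by linarith
    then have "C * W' \<omega> \<le> C * (D * exp (r * K \<omega>))" using assms(4) by (rule mult_left_mono)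
    then show ?thesis using assms(3)[OF that] by simp
  qed
  then show ?thesis
    using assms(2) unfolding exp_dominated_def by blast
qed

lemma abs_falling_factorial_le: "\<bar>falling_factorial x k\<bar> \<le> exp (real k * real k) * exp (real k * \<bar>x\<bar>)"
proof -
  have "\<bar>falling_factorial x k\<bar> \<le> (\<Prod>i<k. exp (real k + \<bar>x\<bar>))"
    unfolding falling_factorial_def abs_prod
  proof (intro prod_mono conjI abs_ge_zero)
    fix i assume "i \<in> {..<k}"
    then have "\<bar>x - real i\<bar> \<le> real k + \<bar>x\<bar>" by auto
    also have "\<dots> \<le> exp (real k + \<bar>x\<bar>)"
      using exp_ge_add_one_self[of "real k + \<bar>x\<bar>"] by linarith
    finally show "\<bar>x - real i\<bar> \<le> exp (real k + \<bar>x\<bar>)" .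
  qed
  also have "\<dots> = exp (real k * real k) * exp (real k * \<bar>x\<bar>)"
    by (simp add: distrib_left flip: exp_add exp_of_nat_mult)
  finally show ?thesis .
qed

lemma falling_factorial_measurable [measurable]: "(\<lambda>x. falling_factorial x k) \<in> borel_measurable borel"
  unfolding falling_factorial_def by measurable

lemma powr_diff_le_exp:
  assumes "0 < z" "\<bar>ln z\<bar> \<le> r"
  shows "z powr (x - real k) \<le> exp (r * real k) * exp (r * \<bar>x\<bar>)"
proof -
  have "(x - real k) * ln z \<le> \<bar>x - real k\<bar> * \<bar>ln z\<bar>"
    by (metis abs_ge_self abs_mult)
  also have "\<dots> \<le> (\<bar>x\<bar> + real k) * r"
    using assms by (intro mult_mono) auto
  finally show ?thesis
    using assms by (simp add: powr_def algebra_simps flip: exp_add)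
qed

lemma exp_dominated_falling_factorial:
  assumes "X \<in> borel_measurable M" "\<And>\<omega>. \<omega> \<in> space M \<Longrightarrow> \<bar>X \<omega>\<bar> \<le> c + d * K \<omega>"
  shows "exp_dominated M K (\<lambda>\<omega>. falling_factorial (X \<omega>) k)"
proof (rule exp_dominated_bound)
  show "exp_dominated M K (\<lambda>\<omega>. exp (real k * \<bar>X \<omega>\<bar>))"
    using assms by (intro exp_dominated_exp_abs) auto
  show "(\<lambda>\<omega>. falling_factorial (X \<omega>) k) \<in> borel_measurable M"
    using assms(1) by measurable
qed (auto intro: abs_falling_factorial_le)

lemma exp_dominated_powr:
  assumes "X \<in> borel_measurable M" "\<And>\<omega>. \<omega> \<in> space M \<Longrightarrow> \<bar>X \<omega>\<bar> \<le> c + d * K \<omega>" "0 < z"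
  shows "exp_dominated M K (\<lambda>\<omega>. z powr (X \<omega> - real k))"
proof (rule exp_dominated_bound)
  show "exp_dominated M K (\<lambda>\<omega>. exp (\<bar>ln z\<bar> * \<bar>X \<omega>\<bar>))"
    using assms by (intro exp_dominated_exp_abs) auto
  show "(\<lambda>\<omega>. z powr (X \<omega> - real k)) \<in> borel_measurable M"
    using assms(1) by measurable
  show "\<bar>z powr (X \<omega> - real k)\<bar> \<le> exp (\<bar>ln z\<bar> * real k) * exp (\<bar>ln z\<bar> * \<bar>X \<omega>\<bar>)" for \<omega>
    using powr_diff_le_exp[OF assms(3) order_refl] by simp
qed auto

context
  fixes M :: "'a measure" and K X W :: "'a \<Rightarrow> real" and c d :: real
  assumes exp_moments: "\<And>r. integrable M (\<lambda>\<omega>. exp (r * K \<omega>))"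
    and X [measurable]: "X \<in> borel_measurable M"
    and X_le: "\<And>\<omega>. \<omega> \<in> space M \<Longrightarrow> \<bar>X \<omega>\<bar> \<le> c + d * K \<omega>"
    and W: "exp_dominated M K W"
begin

lemma exp_dominated_power_moment:
  assumes "0 < z"
  shows "exp_dominated M K (\<lambda>\<omega>. W \<omega> * (falling_factorial (X \<omega>) k * z powr (X \<omega> - real k)))"
  by (intro exp_dominated_mult W exp_dominated_falling_factorial[OF X X_le]
      exp_dominated_powr[OF X X_le assms])

lemma has_real_derivative_power_moment:
  assumes z: "0 < z"
  shows "((\<lambda>y. LINT \<omega>|M. W \<omega> * (falling_factorial (X \<omega>) k * y powr (X \<omega> - real k)))
    has_real_derivative
    (LINT \<omega>|M. W \<omega> * (falling_factorial (X \<omega>) (Suc k) * z powr (X \<omega> - real (Suc k))))) (at z)"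
proof (rule has_real_derivative_integral[where a = "z / 2" and b = "z * 2"
      and f' = "\<lambda>y \<omega>. W \<omega> * (falling_factorial (X \<omega>) (Suc k) * y powr (X \<omega> - real (Suc k)))"])
  define r where "r = \<bar>ln z\<bar> + ln 2"
  define w where "w \<omega> = \<bar>W \<omega>\<bar> * \<bar>falling_factorial (X \<omega>) (Suc k)\<bar> * (exp (r * real (Suc k)) * exp (r * \<bar>X \<omega>\<bar>))" for \<omega>
  show "integrable M (\<lambda>\<omega>. W \<omega> * (falling_factorial (X \<omega>) k * y powr (X \<omega> - real k)))"
    if "z / 2 < y" for y
    using that z by (intro exp_dominated_integrable[OF exp_dominated_power_moment exp_moments]) auto
  show "((\<lambda>y. W \<omega> * (falling_factorial (X \<omega>) k * y powr (X \<omega> - real k))) has_real_derivative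
      W \<omega> * (falling_factorial (X \<omega>) (Suc k) * y powr (X \<omega> - real (Suc k)))) (at y)"
    if "z / 2 < y" for y \<omega>
    using that z
    by (auto intro!: derivative_eq_intros simp: falling_factorial_Suc algebra_simps)
  show "\<bar>W \<omega> * (falling_factorial (X \<omega>) (Suc k) * y powr (X \<omega> - real (Suc k)))\<bar> \<le> w \<omega>"
    if y: "z / 2 < y" "y < z * 2" for y \<omega>
  proof -
    have "ln (z / 2) < ln y" "ln y < ln (z * 2)"
      using y z by simp_all
    then have "\<bar>ln y\<bar> \<le> r"
      using z by (simp add: r_def ln_div ln_mult)
    then have "y powr (X \<omega> - real (Suc k)) \<le> exp (r * real (Suc k)) * exp (r * \<bar>X \<omega>\<bar>)"
      using y z by (intro powr_diff_le_exp) auto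
    then show ?thesis
      unfolding w_def abs_mult mult.assoc by (intro mult_left_mono) auto
  qed
  have abs_dom: "exp_dominated M K (\<lambda>\<omega>. \<bar>V \<omega>\<bar>)" if "exp_dominated M K V" for V
    using that unfolding exp_dominated_def by auto
  have "0 \<le> r" by (simp add: r_def)
  then have "exp_dominated M K w"
    unfolding w_def
    by (intro exp_dominated_mult abs_dom W exp_dominated_falling_factorial[OF X X_le]
        exp_dominated_const exp_dominated_exp_abs[OF X _ X_le])
  then show "integrable M w"
    by (rule exp_dominated_integrable[OF _ exp_moments])
  show "(\<lambda>\<omega>. W \<omega> * (falling_factorial (X \<omega>) (Suc k) * z powr (X \<omega> - real (Suc k)))) \<in> borel_measurable M"
    using exp_dominated_measurable[OF exp_dominated_power_moment[OF z]] .
qed (use z in auto)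

lemma higher_deriv_power_moment:
  assumes "\<And>z. 0 < z \<Longrightarrow> f z = (LINT \<omega>|M. W \<omega> * z powr X \<omega>)" "0 < z"
  shows "(deriv ^^ k) f z = (LINT \<omega>|M. W \<omega> * (falling_factorial (X \<omega>) k * z powr (X \<omega> - real k)))"
  using assms(2)
proof (induction k arbitrary: z)
  case 0
  then show ?case using assms(1) by simp
next
  case (Suc k)
  have "\<forall>\<^sub>F y in nhds z. 0 < y"
    using Suc.prems eventually_nhds_in_open[of "{0<..}" z] by simp
  then have "\<forall>\<^sub>F y in nhds z. (deriv ^^ k) f y
      = (LINT \<omega>|M. W \<omega> * (falling_factorial (X \<omega>) k * y powr (X \<omega> - real k)))"
    by eventually_elim (rule Suc.IH)
  then have "deriv ((deriv ^^ k) f) z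
      = deriv (\<lambda>y. LINT \<omega>|M. W \<omega> * (falling_factorial (X \<omega>) k * y powr (X \<omega> - real k))) z"
    by (intro deriv_cong_ev) auto
  then show ?case
    using DERIV_imp_deriv[OF has_real_derivative_power_moment[OF Suc.prems, of k]] by simp
qed

end

lemma partial_deriv_gen_fun2:
  assumes exp_moments: "\<And>r. integrable M (\<lambda>\<omega>. exp (r * K \<omega>))"
    and X: "X \<in> borel_measurable M" "\<And>\<omega>. \<omega> \<in> space M \<Longrightarrow> \<bar>X \<omega>\<bar> \<le> c + d * K \<omega>"
    and Y: "Y \<in> borel_measurable M" "\<And>\<omega>. \<omega> \<in> space M \<Longrightarrow> \<bar>Y \<omega>\<bar> \<le> c' + d' * K \<omega>"
    and z: "0 < z"
  shows "partial_deriv k l (gen_fun2 M X Y) z 1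
    = (LINT \<omega>|M. falling_factorial (Y \<omega>) l * (falling_factorial (X \<omega>) k * z powr (X \<omega> - real k)))"
proof -
  have inner: "(deriv ^^ l) (\<lambda>y. gen_fun2 M X Y x y) 1 = (LINT \<omega>|M. falling_factorial (Y \<omega>) l * x powr X \<omega>)"
    if "0 < x" for x
  proof -
    have "(deriv ^^ l) (\<lambda>y. gen_fun2 M X Y x y) 1
        = (LINT \<omega>|M. x powr X \<omega> * (falling_factorial (Y \<omega>) l * 1 powr (Y \<omega> - real l)))"
    proof (rule higher_deriv_power_moment[OF exp_moments Y])
      show "exp_dominated M K (\<lambda>\<omega>. x powr X \<omega>)"
        using exp_dominated_powr[OF X that, of 0] by simp
    qed (simp_all add: gen_fun2_def)
    then show ?thesis by (simp add: mult.commute)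
  qed
  show ?thesis
    unfolding partial_deriv_def
    by (rule higher_deriv_power_moment[OF exp_moments X exp_dominated_falling_factorial[OF Y]])
      (use z inner in auto)
qed

section \<open>Independence and laws of integer-valued variables\<close>

text \<open>The joint law of independent elements is the product of their laws, so Tonelli's theorem applies.\<close>

lemma indep_elements_nn_integral:
  assumes "prob_space M" "indep_elements M S X S' Y" "f \<in> borel_measurable (S \<Otimes>\<^sub>M S')"
  shows "(\<integral>\<^sup>+\<omega>. f (X \<omega>, Y \<omega>) \<partial>M) = (\<integral>\<^sup>+\<omega>. (\<integral>\<^sup>+\<omega>'. f (X \<omega>, Y \<omega>') \<partial>M) \<partial>M)"
proof -
  interpret prob_space M by fact
  note [measurable] = assms(3)
  have X [measurable]: "X \<in> measurable M S" and Y [measurable]: "Y \<in> measurable M S'"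
    and indep: "indep_set {X -` B \<inter> space M | B. B \<in> sets S} {Y -` B \<inter> space M | B. B \<in> sets S'}"
    using assms(2) by (auto simp: indep_elements_def)
  interpret X: prob_space "distr M S X" by (rule prob_space_distr[OF X])
  interpret Y: prob_space "distr M S' Y" by (rule prob_space_distr[OF Y])
  have joint: "distr M S X \<Otimes>\<^sub>M distr M S' Y = distr M (S \<Otimes>\<^sub>M S') (\<lambda>\<omega>. (X \<omega>, Y \<omega>))"
  proof (rule pair_measure_eqI)
    fix A B assume AB: "A \<in> sets (distr M S X)" "B \<in> sets (distr M S' Y)"
    then have [measurable]: "A \<in> sets S" "B \<in> sets S'" by auto
    have "prob ((X -` A \<inter> space M) \<inter> (Y -` B \<inter> space M)) = prob (X -` A \<inter> space M) * prob (Y -` B \<inter> space M)"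
      by (rule indep_setD[OF indep]) auto
    moreover have "(X -` A \<inter> space M) \<inter> (Y -` B \<inter> space M) = (\<lambda>\<omega>. (X \<omega>, Y \<omega>)) -` (A \<times> B) \<inter> space M"
      by auto
    ultimately show "emeasure (distr M S X) A * emeasure (distr M S' Y) B
        = emeasure (distr M (S \<Otimes>\<^sub>M S') (\<lambda>\<omega>. (X \<omega>, Y \<omega>))) (A \<times> B)"
      by (simp add: emeasure_distr emeasure_eq_measure flip: ennreal_mult)
  qed (auto intro: X.sigma_finite_measure Y.sigma_finite_measure
      simp: X.sigma_finite_measure_axioms Y.sigma_finite_measure_axioms cong: sets_pair_measure_cong)
  have "(\<integral>\<^sup>+\<omega>. f (X \<omega>, Y \<omega>) \<partial>M) = (\<integral>\<^sup>+z. f z \<partial>(distr M S X \<Otimes>\<^sub>M distr M S' Y))"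
    unfolding joint by (simp add: nn_integral_distr)
  also have "\<dots> = (\<integral>\<^sup>+x. (\<integral>\<^sup>+y. f (x, y) \<partial>distr M S' Y) \<partial>distr M S X)"
    by (rule Y.nn_integral_fst[symmetric]) simp
  also have "\<dots> = (\<integral>\<^sup>+\<omega>. (\<integral>\<^sup>+y. f (X \<omega>, y) \<partial>distr M S' Y) \<partial>M)"
    by (rule nn_integral_distr) (auto intro: Y.borel_measurable_nn_integral_fst)
  also have "\<dots> = (\<integral>\<^sup>+\<omega>. (\<integral>\<^sup>+\<omega>'. f (X \<omega>, Y \<omega>') \<partial>M) \<partial>M)"
  proof (rule nn_integral_cong)
    fix \<omega> assume "\<omega> \<in> space M"
    then have "X \<omega> \<in> space S" using X by (rule measurable_space[rotated])
    then show "(\<integral>\<^sup>+y. f (X \<omega>, y) \<partial>distr M S' Y) = (\<integral>\<^sup>+\<omega>'. f (X \<omega>, Y \<omega>') \<partial>M)"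
      by (intro nn_integral_distr) auto
  qed
  finally show ?thesis .
qed

lemma (in prob_space) AE_in_Nats:
  assumes [measurable]: "X \<in> borel_measurable M"
    and "(\<lambda>k::nat. prob {\<omega> \<in> space M. X \<omega> = real k}) sums 1"
  shows "AE \<omega> in M. X \<omega> \<in> \<nat>"
proof -
  let ?A = "\<lambda>k::nat. {\<omega> \<in> space M. X \<omega> = real k}"
  have "(\<lambda>k. prob (?A k)) sums prob (\<Union>k. ?A k)"
    by (rule finite_measure_UNION) (auto simp: disjoint_family_on_def)
  then have "prob (\<Union>k. ?A k) = 1"
    using assms(2) by (rule sums_unique2)
  moreover have "(\<Union>k. ?A k) = {\<omega> \<in> space M. X \<omega> \<in> \<nat>}"
    by (auto elim: Nats_cases)
  moreover have "(\<Union>k. ?A k) \<in> sets M" by measurable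
  ultimately show ?thesis
    using prob_Collect_eq_1[of "\<lambda>\<omega>. X \<omega> \<in> \<nat>"] by simp
qed

lemma (in prob_space) mixture_sums:
  fixes c :: "nat \<Rightarrow> 'a \<Rightarrow> real"
  assumes [measurable]: "\<And>k. c k \<in> borel_measurable M" "W \<in> borel_measurable M" "S \<in> borel_measurable M"
    and c: "AE \<omega> in M. \<forall>k. 0 \<le> c k \<omega> \<and> c k \<omega> \<le> 1" and W: "AE \<omega> in M. 0 \<le> W \<omega> \<and> W \<omega> \<le> 1"
    and S: "AE \<omega> in M. (\<lambda>k. c k \<omega> * x ^ k) sums S \<omega>" and x: "0 \<le> x" "x < 1"
  shows "(\<lambda>k. expectation (\<lambda>\<omega>. c k \<omega> * W \<omega>) * x ^ k) sums expectation (\<lambda>\<omega>. S \<omega> * W \<omega>)"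
proof -
  have bound: "AE \<omega> in M. norm (c k \<omega> * W \<omega>) \<le> 1" for k
    using c W by eventually_elim (auto simp: abs_mult intro: mult_le_one)
  have int: "integrable M (\<lambda>\<omega>. c k \<omega> * W \<omega>)" for k
    using bound by (rule integrable_const_bound) simp
  have norm: "AE \<omega> in M. norm (c k \<omega> * W \<omega> * x ^ k) \<le> x ^ k" for k
    using bound[of k] by eventually_elim (use x in \<open>simp add: abs_mult mult_left_le_one_le\<close>)
  have "(\<lambda>k. expectation (\<lambda>\<omega>. c k \<omega> * W \<omega> * x ^ k)) sums expectation (\<lambda>\<omega>. \<Sum>k. c k \<omega> * W \<omega> * x ^ k)"
  proof (rule sums_integral)
    show "integrable M (\<lambda>\<omega>. c k \<omega> * W \<omega> * x ^ k)" for k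
      using int by simp
    have "AE \<omega> in M. \<forall>k. norm (c k \<omega> * W \<omega> * x ^ k) \<le> x ^ k"
      using norm by (simp add: AE_all_countable)
    then show "AE \<omega> in M. summable (\<lambda>k. norm (c k \<omega> * W \<omega> * x ^ k))"
    proof eventually_elim
      fix \<omega> assume "\<forall>k. norm (c k \<omega> * W \<omega> * x ^ k) \<le> x ^ k"
      then show "summable (\<lambda>k. norm (c k \<omega> * W \<omega> * x ^ k))"
        using x by (intro summable_comparison_test[OF _ summable_geometric[of x]]) auto
    qed
    show "summable (\<lambda>k. expectation (\<lambda>\<omega>. norm (c k \<omega> * W \<omega> * x ^ k)))"
    proof (rule summable_comparison_test[OF _ summable_geometric[of x]], intro exI allI impI)
      fix k
      have "expectation (\<lambda>\<omega>. norm (c k \<omega> * W \<omega> * x ^ k)) \<le> expectation (\<lambda>\<omega>. x ^ k)"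
        using int norm by (intro integral_mono_AE) auto
      then show "norm (expectation (\<lambda>\<omega>. norm (c k \<omega> * W \<omega> * x ^ k))) \<le> x ^ k"
        by (simp add: prob_space)
    qed (use x in auto)
  qed
  moreover have "expectation (\<lambda>\<omega>. \<Sum>k. c k \<omega> * W \<omega> * x ^ k) = expectation (\<lambda>\<omega>. S \<omega> * W \<omega>)"
  proof (rule integral_cong_AE)
    show "AE \<omega> in M. (\<Sum>k. c k \<omega> * W \<omega> * x ^ k) = S \<omega> * W \<omega>"
      using S
    proof eventually_elim
      fix \<omega> assume "(\<lambda>k. c k \<omega> * x ^ k) sums S \<omega>"
      then have "(\<lambda>k. c k \<omega> * x ^ k * W \<omega>) sums (S \<omega> * W \<omega>)"
        by (rule sums_mult2)
      then show "(\<Sum>k. c k \<omega> * W \<omega> * x ^ k) = S \<omega> * W \<omega>"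
        by (simp add: sums_iff mult_ac)
    qed
  qed auto
  ultimately show ?thesis by simp
qed

text \<open>
  A family \<open>c k\<close> of weights stands either for the indicators of \<open>U = k\<close>, with generating
  function \<open>x powr U\<close>, or for the mass function of a law with random parameter, with its
  probability generating function. Uniqueness of power series coefficients, first in one
  variable and then in the other, passes from joint generating functions to joint laws.
\<close>

definition (in prob_space) weights_with_pgf :: "(nat \<Rightarrow> 'a \<Rightarrow> real) \<Rightarrow> (real \<Rightarrow> 'a \<Rightarrow> real) \<Rightarrow> bool" where
  "weights_with_pgf c S \<longleftrightarrow>
    (\<forall>k. c k \<in> borel_measurable M) \<and> (\<forall>x. S x \<in> borel_measurable M) \<and>
    (AE \<omega> in M. \<forall>k. 0 \<le> c k \<omega> \<and> c k \<omega> \<le> 1) \<and>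
    (\<forall>x. 0 < x \<longrightarrow> x < 1 \<longrightarrow> (AE \<omega> in M. 0 \<le> S x \<omega> \<and> S x \<omega> \<le> 1 \<and> (\<lambda>k. c k \<omega> * x ^ k) sums S x \<omega>))"

lemma (in prob_space) weights_expectation_sums:
  assumes "weights_with_pgf c S" "W \<in> borel_measurable M" "AE \<omega> in M. 0 \<le> W \<omega> \<and> W \<omega> \<le> 1" "0 < x" "x < 1"
  shows "(\<lambda>k. expectation (\<lambda>\<omega>. c k \<omega> * W \<omega>) * x ^ k) sums expectation (\<lambda>\<omega>. S x \<omega> * W \<omega>)"
proof (rule mixture_sums)
  have "AE \<omega> in M. 0 \<le> S x \<omega> \<and> S x \<omega> \<le> 1 \<and> (\<lambda>k. c k \<omega> * x ^ k) sums S x \<omega>"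
    using assms by (auto simp: weights_with_pgf_def)
  then show "AE \<omega> in M. (\<lambda>k. c k \<omega> * x ^ k) sums S x \<omega>" by eventually_elim auto
qed (use assms in \<open>auto simp: weights_with_pgf_def\<close>)

lemma (in prob_space) bounded_weights_expectation:
  assumes "weights_with_pgf c S" "W \<in> borel_measurable M" "AE \<omega> in M. 0 \<le> W \<omega> \<and> W \<omega> \<le> 1"
  shows "bounded (range (\<lambda>k. expectation (\<lambda>\<omega>. c k \<omega> * W \<omega>)))"
proof -
  have c: "AE \<omega> in M. \<forall>k. 0 \<le> c k \<omega> \<and> c k \<omega> \<le> 1"
    using assms(1) by (simp add: weights_with_pgf_def)
  have "\<bar>expectation (\<lambda>\<omega>. c k \<omega> * W \<omega>)\<bar> \<le> 1" for k
  proof -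
    have bound: "AE \<omega> in M. norm (c k \<omega> * W \<omega>) \<le> 1"
      using c assms(3) by eventually_elim (auto simp: abs_mult intro: mult_le_one)
    have "(\<lambda>\<omega>. c k \<omega> * W \<omega>) \<in> borel_measurable M"
      using assms unfolding weights_with_pgf_def by (intro borel_measurable_times) auto
    with bound have "integrable M (\<lambda>\<omega>. c k \<omega> * W \<omega>)"
      by (rule integrable_const_bound)
    then have "expectation (\<lambda>\<omega>. norm (c k \<omega> * W \<omega>)) \<le> expectation (\<lambda>\<omega>. 1)"
      using bound by (intro integral_mono_AE) auto
    with integral_norm_bound have "norm (expectation (\<lambda>\<omega>. c k \<omega> * W \<omega>)) \<le> expectation (\<lambda>\<omega>. 1)"
      by (rule order_trans)
    then show ?thesis
      by (simp add: prob_space)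
  qed
  then show ?thesis by (auto simp: bounded_iff)
qed

text \<open>
  For fixed \<open>y\<close> both sides are power series in \<open>x\<close>; comparing coefficients leaves, for each \<open>k\<close>,
  two power series in \<open>y\<close>, which are compared in turn.
\<close>

lemma (in prob_space) joint_weights_eq:
  assumes c: "weights_with_pgf c S" "weights_with_pgf c' S'" "weights_with_pgf d Z" "weights_with_pgf d' Z'"
    and eq: "\<And>x y. 0 < x \<Longrightarrow> x < 1 \<Longrightarrow> 0 < y \<Longrightarrow> y < 1 \<Longrightarrow>
      expectation (\<lambda>\<omega>. S x \<omega> * Z y \<omega>) = expectation (\<lambda>\<omega>. S' x \<omega> * Z' y \<omega>)"
  shows "expectation (\<lambda>\<omega>. c k \<omega> * d l \<omega>) = expectation (\<lambda>\<omega>. c' k \<omega> * d' l \<omega>)"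
proof -
  have W: "Z y \<in> borel_measurable M" "AE \<omega> in M. 0 \<le> Z y \<omega> \<and> Z y \<omega> \<le> 1"
    if "weights_with_pgf d Z" "0 < y" "y < 1" for d Z y
    using that unfolding weights_with_pgf_def by (auto elim!: allE[of _ y])
  have D: "d l \<in> borel_measurable M" "AE \<omega> in M. 0 \<le> d l \<omega> \<and> d l \<omega> \<le> 1"
    if "weights_with_pgf d Z" for d Z l
    using that unfolding weights_with_pgf_def by auto
  have half: "expectation (\<lambda>\<omega>. c k \<omega> * Z y \<omega>) = expectation (\<lambda>\<omega>. c' k \<omega> * Z' y \<omega>)"
    if y: "0 < y" "y < 1" for k y
  proof (rule power_series_eq_imp_coeff_eq[of "\<lambda>k. expectation (\<lambda>\<omega>. c k \<omega> * Z y \<omega>)"])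
    fix x :: real assume x: "0 < x" "x < 1"
    show "\<exists>e. (\<lambda>n. expectation (\<lambda>\<omega>. c n \<omega> * Z y \<omega>) * x ^ n) sums e \<and>
        (\<lambda>n. expectation (\<lambda>\<omega>. c' n \<omega> * Z' y \<omega>) * x ^ n) sums e"
      using weights_expectation_sums[OF c(1) W[OF c(3) y] x]
        weights_expectation_sums[OF c(2) W[OF c(4) y] x] eq[OF x y] by auto
  qed (intro bounded_weights_expectation[OF c(1) W[OF c(3) y]] bounded_weights_expectation[OF c(2) W[OF c(4) y]])+
  have "expectation (\<lambda>\<omega>. d l \<omega> * c k \<omega>) = expectation (\<lambda>\<omega>. d' l \<omega> * c' k \<omega>)"
  proof (rule power_series_eq_imp_coeff_eq[of "\<lambda>l. expectation (\<lambda>\<omega>. d l \<omega> * c k \<omega>)"])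
    fix y :: real assume y: "0 < y" "y < 1"
    show "\<exists>e. (\<lambda>n. expectation (\<lambda>\<omega>. d n \<omega> * c k \<omega>) * y ^ n) sums e \<and>
        (\<lambda>n. expectation (\<lambda>\<omega>. d' n \<omega> * c' k \<omega>) * y ^ n) sums e"
      using weights_expectation_sums[OF c(3) D[OF c(1)] y, of k]
        weights_expectation_sums[OF c(4) D[OF c(2)] y, of k] half[OF y, of k]
      by (auto simp: mult.commute)
  qed (intro bounded_weights_expectation[OF c(3) D[OF c(1)]] bounded_weights_expectation[OF c(4) D[OF c(2)]])+
  then show ?thesis by (simp add: mult.commute)
qed

lemma (in prob_space) weights_with_pgf_indicator:
  assumes [measurable]: "U \<in> borel_measurable M" and nat: "AE \<omega> in M. U \<omega> \<in> \<nat>"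
  shows "weights_with_pgf (\<lambda>k \<omega>. if U \<omega> = real k then 1 else 0) (\<lambda>x \<omega>. x powr U \<omega>)"
  unfolding weights_with_pgf_def
proof (intro conjI allI impI)
  fix x :: real assume x: "0 < x" "x < 1"
  show "AE \<omega> in M. 0 \<le> x powr U \<omega> \<and> x powr U \<omega> \<le> 1
      \<and> (\<lambda>k. (if U \<omega> = real k then 1 else 0) * x ^ k) sums x powr U \<omega>"
    using nat
  proof eventually_elim
    fix \<omega> assume "U \<omega> \<in> \<nat>"
    then obtain n where n: "U \<omega> = real n" by (auto elim: Nats_cases)
    have "(\<lambda>k. if k = n then x ^ k else 0) sums x ^ n"
      by (rule sums_single)
    also have "(\<lambda>k. if k = n then x ^ k else 0) = (\<lambda>k. (if U \<omega> = real k then 1 else 0) * x ^ k)"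
      using n by auto
    finally show "0 \<le> x powr U \<omega> \<and> x powr U \<omega> \<le> 1
        \<and> (\<lambda>k. (if U \<omega> = real k then 1 else 0) * x ^ k) sums x powr U \<omega>"
      using x n by (simp add: powr_realpow power_le_one)
  qed
qed auto

lemma nb_mass_measurable [measurable]: "(\<lambda>r. nb_mass p r k) \<in> borel_measurable borel"
  unfolding nb_mass_pochhammer pochhammer_prod by measurable

lemma nb_mass_le_1:
  assumes "0 < p" "p < 1" "0 \<le> r" shows "nb_mass p r k \<le> 1"
proof -
  have "summable (nb_mass p r)" "suminf (nb_mass p r) = 1"
    using nb_mass_sums_1[OF assms(1,2), of r] by (auto simp: sums_iff)
  then show ?thesis
    using sum_le_suminf[of "nb_mass p r" "{k}"] nb_mass_nonneg[OF assms(3)] assms(2) by simp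
qed

lemma pgf_base_bounds:
  fixes p x :: real
  assumes "0 < p" "p < 1" "0 \<le> x" "x \<le> 1"
  shows "0 < p / (1 - (1 - p) * x)" "p / (1 - (1 - p) * x) \<le> 1"
proof -
  have "(1 - p) * x \<le> 1 - p"
    using assms by (intro mult_left_le) auto
  then have "p \<le> 1 - (1 - p) * x" by linarith
  then show "0 < p / (1 - (1 - p) * x)" "p / (1 - (1 - p) * x) \<le> 1"
    using assms(1) by (simp_all add: divide_simps)
qed

lemma (in prob_space) weights_with_pgf_nb_mass:
  assumes [measurable]: "X \<in> borel_measurable M" and X: "\<And>\<omega>. \<omega> \<in> space M \<Longrightarrow> 0 \<le> X \<omega>"
    and p: "0 < p" "p < 1"
  shows "weights_with_pgf (\<lambda>k \<omega>. nb_mass p (X \<omega>) k) (\<lambda>x \<omega>. (p / (1 - (1 - p) * x)) powr X \<omega>)"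
  unfolding weights_with_pgf_def
proof (intro conjI allI impI)
  show "AE \<omega> in M. \<forall>k. 0 \<le> nb_mass p (X \<omega>) k \<and> nb_mass p (X \<omega>) k \<le> 1"
    using X p by (intro AE_I2) (auto intro: nb_mass_nonneg nb_mass_le_1)
  fix x :: real assume x: "0 < x" "x < 1"
  show "AE \<omega> in M. 0 \<le> (p / (1 - (1 - p) * x)) powr X \<omega> \<and> (p / (1 - (1 - p) * x)) powr X \<omega> \<le> 1
      \<and> (\<lambda>k. nb_mass p (X \<omega>) k * x ^ k) sums ((p / (1 - (1 - p) * x)) powr X \<omega>)"
    using X p x pgf_base_bounds[OF p, of x]
    by (intro AE_I2 conjI nb_mass_pgf powr_le1) (simp_all only: abs_of_pos powr_ge_zero)
qed auto

text \<open>
  Passing from the joint law to moments restricted to an event: all terms are nonnegative, so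
  the sum over the values of \<open>W\<close> may be exchanged with the expectation, and integrability of
  \<open>g W\<close> comes with the identity.
\<close>

lemma (in prob_space) expectation_from_joint_weights:
  fixes d :: "nat \<Rightarrow> 'a \<Rightarrow> real" and g :: "real \<Rightarrow> real"
  assumes [measurable]: "c \<in> borel_measurable M" "W \<in> borel_measurable M" "c' \<in> borel_measurable M"
      "\<And>l. d l \<in> borel_measurable M" "g \<in> borel_measurable borel"
    and nat: "AE \<omega> in M. W \<omega> \<in> \<nat>"
    and c: "\<And>\<omega>. \<omega> \<in> space M \<Longrightarrow> 0 \<le> c \<omega> \<and> c \<omega> \<le> 1"
    and c': "\<And>\<omega>. \<omega> \<in> space M \<Longrightarrow> 0 \<le> c' \<omega> \<and> c' \<omega> \<le> 1"
    and d: "\<And>l \<omega>. \<omega> \<in> space M \<Longrightarrow> 0 \<le> d l \<omega> \<and> d l \<omega> \<le> 1"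
    and g: "\<And>l::nat. 0 \<le> g (real l)"
    and eq: "\<And>l. expectation (\<lambda>\<omega>. c \<omega> * (if W \<omega> = real l then 1 else 0)) = expectation (\<lambda>\<omega>. c' \<omega> * d l \<omega>)"
    and h: "\<And>\<omega>. \<omega> \<in> space M \<Longrightarrow> (\<lambda>l. g (real l) * d l \<omega>) sums h \<omega>"
    and int: "integrable M (\<lambda>\<omega>. c' \<omega> * h \<omega>)"
  shows "integrable M (\<lambda>\<omega>. c \<omega> * g (W \<omega>))"
    and "expectation (\<lambda>\<omega>. c \<omega> * g (W \<omega>)) = expectation (\<lambda>\<omega>. c' \<omega> * h \<omega>)"
proof -
  have h_nonneg: "0 \<le> h \<omega>" if "\<omega> \<in> space M" for \<omega>
    by (rule sums_le[OF _ sums_zero h[OF that]]) (use d[OF that] g in auto)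
  have "(\<integral>\<^sup>+\<omega>. ennreal (c \<omega> * g (W \<omega>)) \<partial>M)
      = (\<integral>\<^sup>+\<omega>. (\<Sum>l. ennreal (g (real l) * (c \<omega> * (if W \<omega> = real l then 1 else 0)))) \<partial>M)"
  proof (rule nn_integral_cong_AE)
    show "AE \<omega> in M. ennreal (c \<omega> * g (W \<omega>)) = (\<Sum>l. ennreal (g (real l) * (c \<omega> * (if W \<omega> = real l then 1 else 0))))"
      using nat
    proof eventually_elim
      fix \<omega> assume "W \<omega> \<in> \<nat>"
      then obtain n where n: "W \<omega> = real n" by (auto elim: Nats_cases)
      have "(\<Sum>l. ennreal (g (real l) * (c \<omega> * (if W \<omega> = real l then 1 else 0))))
          = (\<Sum>l\<in>{n}. ennreal (g (real l) * (c \<omega> * (if W \<omega> = real l then 1 else 0))))"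
        using n by (intro suminf_finite) auto
      then show "ennreal (c \<omega> * g (W \<omega>)) = (\<Sum>l. ennreal (g (real l) * (c \<omega> * (if W \<omega> = real l then 1 else 0))))"
        using n by (simp add: mult.commute)
    qed
  qed
  also have "\<dots> = (\<Sum>l. \<integral>\<^sup>+\<omega>. ennreal (g (real l) * (c \<omega> * (if W \<omega> = real l then 1 else 0))) \<partial>M)"
    by (rule nn_integral_suminf) measurable
  also have "\<dots> = (\<Sum>l. \<integral>\<^sup>+\<omega>. ennreal (g (real l) * (c' \<omega> * d l \<omega>)) \<partial>M)"
  proof (intro suminf_cong)
    fix l
    have "integrable M (\<lambda>\<omega>. c \<omega> * (if W \<omega> = real l then 1 else 0))"
      using c by (intro integrable_const_bound[where B = 1] AE_I2) auto
    moreover have "integrable M (\<lambda>\<omega>. c' \<omega> * d l \<omega>)"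
      using c' d by (intro integrable_const_bound[where B = 1] AE_I2) (auto simp: abs_mult intro: mult_le_one)
    ultimately have "(\<integral>\<^sup>+\<omega>. ennreal (g (real l) * (c \<omega> * (if W \<omega> = real l then 1 else 0))) \<partial>M)
        = ennreal (g (real l) * expectation (\<lambda>\<omega>. c \<omega> * (if W \<omega> = real l then 1 else 0)))"
      "(\<integral>\<^sup>+\<omega>. ennreal (g (real l) * (c' \<omega> * d l \<omega>)) \<partial>M)
        = ennreal (g (real l) * expectation (\<lambda>\<omega>. c' \<omega> * d l \<omega>))"
      using c c' d g by (subst nn_integral_eq_integral; auto intro!: AE_I2)+
    then show "(\<integral>\<^sup>+\<omega>. ennreal (g (real l) * (c \<omega> * (if W \<omega> = real l then 1 else 0))) \<partial>M)
        = (\<integral>\<^sup>+\<omega>. ennreal (g (real l) * (c' \<omega> * d l \<omega>)) \<partial>M)"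
      using eq by simp
  qed
  also have "\<dots> = (\<integral>\<^sup>+\<omega>. (\<Sum>l. ennreal (g (real l) * (c' \<omega> * d l \<omega>))) \<partial>M)"
    by (rule nn_integral_suminf[symmetric]) measurable
  also have "\<dots> = (\<integral>\<^sup>+\<omega>. ennreal (c' \<omega> * h \<omega>) \<partial>M)"
  proof (rule nn_integral_cong)
    fix \<omega> assume \<omega>: "\<omega> \<in> space M"
    have "(\<lambda>l. g (real l) * (c' \<omega> * d l \<omega>)) sums (c' \<omega> * h \<omega>)"
      using sums_mult[OF h[OF \<omega>], of "c' \<omega>"] by (simp add: mult_ac)
    then show "(\<Sum>l. ennreal (g (real l) * (c' \<omega> * d l \<omega>))) = ennreal (c' \<omega> * h \<omega>)"
      using c'[OF \<omega>] d[OF \<omega>] g by (intro suminf_ennreal_eq) auto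
  qed
  also have "\<dots> = ennreal (expectation (\<lambda>\<omega>. c' \<omega> * h \<omega>))"
    using int c' h_nonneg by (intro nn_integral_eq_integral AE_I2) auto
  finally have *: "(\<integral>\<^sup>+\<omega>. ennreal (c \<omega> * g (W \<omega>)) \<partial>M) = ennreal (expectation (\<lambda>\<omega>. c' \<omega> * h \<omega>))" .
  have nonneg: "AE \<omega> in M. 0 \<le> c \<omega> * g (W \<omega>)"
    using nat AE_space by eventually_elim (use c g in \<open>auto elim!: Nats_cases\<close>)
  show "integrable M (\<lambda>\<omega>. c \<omega> * g (W \<omega>))"
    by (rule integrableI_nonneg[OF _ nonneg]) (use * in auto)
  have "0 \<le> expectation (\<lambda>\<omega>. c' \<omega> * h \<omega>)"
    using c' h_nonneg by (intro integral_nonneg_AE AE_I2) auto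
  then show "expectation (\<lambda>\<omega>. c \<omega> * g (W \<omega>)) = expectation (\<lambda>\<omega>. c' \<omega> * h \<omega>)"
    by (subst integral_eq_nn_integral[OF _ nonneg]) (simp_all add: *)
qed

lemma (in prob_space) integral_uniform_measure:
  fixes f :: "'a \<Rightarrow> real"
  assumes [measurable]: "f \<in> borel_measurable M" "A \<in> sets M"
  shows "(LINT \<omega>|uniform_measure M A. f \<omega>) = expectation (\<lambda>\<omega>. indicator A \<omega> * f \<omega>) / prob A"
proof (cases "prob A = 0")
  case True
  then have "emeasure M A = 0" by (simp add: emeasure_eq_measure)
  then have "AE \<omega> in M. \<omega> \<notin> A" by (intro AE_not_in) auto
  then have "AE \<omega> in uniform_measure M A. f \<omega> = 0"
    unfolding uniform_measure_def by (subst AE_density) auto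
  then have "(LINT \<omega>|uniform_measure M A. f \<omega>) = 0"
    by (intro integral_eq_zero_AE)
  then show ?thesis using True by simp
next
  case False
  then have "uniform_measure M A = density M (\<lambda>\<omega>. ennreal (indicator A \<omega> / prob A))"
    unfolding uniform_measure_def
    by (intro density_cong) (auto simp: emeasure_eq_measure divide_ennreal[symmetric] zero_less_measure_iff split: split_indicator)
  then show ?thesis
    by (simp add: integral_density)
qed

section \<open>The points of the Poisson process\<close>

text \<open>
  \<open>cell n v\<close> numbers the cell of the mesh \<open>1 / (n + 1)\<close> that contains \<open>v\<close>, and \<open>grid n\<close> returns
  the left end point of a cell. The left end points are strictly smaller than \<open>v\<close>, so that
  \<open>t - grid n (cell n v)\<close> approaches \<open>t - v\<close> strictly from the right, as right-continuity of the
  paths of the clusters requires.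
\<close>

definition cell :: "nat \<Rightarrow> real \<Rightarrow> int" where
  "cell n v = \<lceil>real (Suc n) * v\<rceil>"

definition grid :: "nat \<Rightarrow> int \<Rightarrow> real" where
  "grid n i = (real_of_int i - 1) / real (Suc n)"

lemma cell_measurable [measurable]: "cell n \<in> measurable borel (count_space UNIV)"
  unfolding cell_def by measurable

lemma grid_cell_less: "grid n (cell n v) < v"
proof -
  have "real_of_int \<lceil>real (Suc n) * v\<rceil> - 1 < real (Suc n) * v" by linarith
  then show ?thesis
    by (simp add: grid_def cell_def divide_less_eq mult.commute)
qed

lemma grid_cell_ge: "v - 1 / real (Suc n) \<le> grid n (cell n v)"
proof -
  have "real (Suc n) * v \<le> real_of_int \<lceil>real (Suc n) * v\<rceil>" by linarith
  then have "(real (Suc n) * v - 1) / real (Suc n) \<le> grid n (cell n v)"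
    unfolding grid_def cell_def by (intro divide_right_mono) auto
  then show ?thesis
    by (simp add: diff_divide_distrib)
qed

lemma grid_cell_tendsto: "(\<lambda>n. grid n (cell n v)) \<longlonglongrightarrow> v"
proof (rule tendsto_sandwich[where h = "\<lambda>_. v"])
  have "(\<lambda>n. v - 1 / real (Suc n)) \<longlonglongrightarrow> v - 0"
    by (intro tendsto_diff tendsto_const LIMSEQ_Suc[OF lim_1_over_n])
  then show "(\<lambda>n. v - 1 / real (Suc n)) \<longlonglongrightarrow> v" by simp
qed (intro always_eventually allI grid_cell_ge less_imp_le[OF grid_cell_less] tendsto_const)+

lemma cell_range: "v \<in> {0..1} \<Longrightarrow> cell n v \<in> {0..int (Suc n)}"
proof -
  assume v: "v \<in> {0..1}"
  then have "real (Suc n) * v \<le> real (Suc n)" by (intro mult_left_le) auto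
  moreover have "0 \<le> real (Suc n) * v" using v by auto
  ultimately have "0 \<le> \<lceil>real (Suc n) * v\<rceil>" "\<lceil>real (Suc n) * v\<rceil> \<le> int (Suc n)" by linarith+
  then show ?thesis
    unfolding cell_def by (simp del: of_nat_Suc)
qed

lemma grid_le_1: "i \<le> int (Suc n) \<Longrightarrow> grid n i \<le> 1"
proof -
  assume "i \<le> int (Suc n)"
  then have "real_of_int i - 1 \<le> real (Suc n)" by linarith
  then show ?thesis
    by (simp add: grid_def divide_le_eq)
qed

definition exit_index :: "(nat \<Rightarrow> ereal) \<Rightarrow> nat" where
  "exit_index \<tau> = (LEAST j. \<tau> j \<notin> {0..1})"

lemma exit_index_measurable [measurable]:
  "exit_index \<in> measurable (PiM UNIV (\<lambda>_. borel)) (count_space UNIV)"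
  unfolding exit_index_def by measurable

lemma ereal_image_unit_interval: "ereal ` {0..1} = {0..1}"
proof
  show "{0..1} \<subseteq> ereal ` {0..1}"
  proof
    fix x :: ereal assume "x \<in> {0..1}"
    then show "x \<in> ereal ` {0..1}" by (cases x) auto
  qed
qed auto

text \<open>
  Almost surely the points in the unit interval come first, so their number is a measurable
  function of the point sequence and they are exactly the points with smaller index.
\<close>

lemma AE_points_in_unit_interval:
  assumes "point_sequence M T"
  shows "AE \<omega> in M. {j. T j \<omega> \<in> ereal ` {0..1}} = {..<exit_index (\<lambda>j. T j \<omega>)}"
proof -
  have "AE \<omega> in M. 0 < T 0 \<omega>"
    "AE \<omega> in M. \<forall>j. (T j \<omega> \<noteq> \<infinity> \<longrightarrow> T j \<omega> < T (Suc j) \<omega>) \<and> (T j \<omega> = \<infinity> \<longrightarrow> T (Suc j) \<omega> = \<infinity>)"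
    "AE \<omega> in M. \<forall>x::real. finite {j. T j \<omega> \<le> ereal x}"
    using assms by (auto simp: point_sequence_def)
  then show ?thesis
  proof eventually_elim
    fix \<omega>
    assume T0: "0 < T 0 \<omega>"
      and T: "\<forall>j. (T j \<omega> \<noteq> \<infinity> \<longrightarrow> T j \<omega> < T (Suc j) \<omega>) \<and> (T j \<omega> = \<infinity> \<longrightarrow> T (Suc j) \<omega> = \<infinity>)"
      and fin: "\<forall>x::real. finite {j. T j \<omega> \<le> ereal x}"
    have "T j \<omega> \<le> T (Suc j) \<omega>" for j
      using T by (cases "T j \<omega> = \<infinity>") (auto intro: less_imp_le)
    then have mono: "T i \<omega> \<le> T j \<omega>" if "i \<le> j" for i j
      using lift_Suc_mono_le[of "\<lambda>j. T j \<omega>"] that by blast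
    define J where "J = {j. T j \<omega> \<in> {0..1}}"
    have "finite J"
      using fin[rule_format, of 1] by (rule rev_finite_subset) (auto simp: J_def one_ereal_def)
    then obtain k where "k \<notin> J"
      using ex_new_if_finite infinite_UNIV_nat by blast
    then have e: "exit_index (\<lambda>j. T j \<omega>) \<notin> J"
      using LeastI[of "\<lambda>j. T j \<omega> \<notin> {0..1}" k] by (simp add: J_def exit_index_def)
    have down: "i \<in> J" if "j \<in> J" "i \<le> j" for i j
      using mono[of 0 i] mono[of i j] T0 that by (auto simp: J_def)
    have "J = {..<exit_index (\<lambda>j. T j \<omega>)}"
    proof
      show "{..<exit_index (\<lambda>j. T j \<omega>)} \<subseteq> J"
      proof
        fix j assume "j \<in> {..<exit_index (\<lambda>j. T j \<omega>)}"
        then have "j < (LEAST j. T j \<omega> \<notin> {0..1})" by (simp add: exit_index_def)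
        from not_less_Least[OF this] show "j \<in> J" by (simp add: J_def)
      qed
      show "J \<subseteq> {..<exit_index (\<lambda>j. T j \<omega>)}"
      proof
        fix j assume "j \<in> J"
        from e down[OF this] show "j \<in> {..<exit_index (\<lambda>j. T j \<omega>)}"
          by (cases "j < exit_index (\<lambda>j. T j \<omega>)") auto
      qed
    qed
    then show "{j. T j \<omega> \<in> ereal ` {0..1}} = {..<exit_index (\<lambda>j. T j \<omega>)}"
      unfolding J_def ereal_image_unit_interval .
  qed
qed

text \<open>Stated for all \<open>z \<ge> 0\<close>, because \<open>z > 1\<close> yields the exponential moments of the count.\<close>

lemma (in prob_space) poisson_pgf:
  assumes [measurable]: "N \<in> measurable M (count_space UNIV)"
    and N: "\<And>k. prob {\<omega> \<in> space M. N \<omega> = k} = exp (- r) * r ^ k / fact k" and "0 \<le> r" "0 \<le> z"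
  shows "(\<integral>\<^sup>+\<omega>. ennreal (z ^ N \<omega>) \<partial>M) = ennreal (exp (r * (z - 1)))"
proof -
  have "(\<integral>\<^sup>+\<omega>. ennreal (z ^ N \<omega>) \<partial>M)
      = (\<integral>\<^sup>+\<omega>. (\<Sum>k. ennreal (z ^ k) * indicator {\<omega> \<in> space M. N \<omega> = k} \<omega>) \<partial>M)"
  proof (rule nn_integral_cong)
    fix \<omega> assume "\<omega> \<in> space M"
    then have "(\<Sum>k. ennreal (z ^ k) * indicator {\<omega> \<in> space M. N \<omega> = k} \<omega>)
        = (\<Sum>k\<in>{N \<omega>}. ennreal (z ^ k) * indicator {\<omega> \<in> space M. N \<omega> = k} \<omega>)"
      by (intro suminf_finite) auto
    then show "ennreal (z ^ N \<omega>) = (\<Sum>k. ennreal (z ^ k) * indicator {\<omega> \<in> space M. N \<omega> = k} \<omega>)"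
      using \<open>\<omega> \<in> space M\<close> by simp
  qed
  also have "\<dots> = (\<Sum>k. \<integral>\<^sup>+\<omega>. ennreal (z ^ k) * indicator {\<omega> \<in> space M. N \<omega> = k} \<omega> \<partial>M)"
    by (rule nn_integral_suminf) measurable
  also have "\<dots> = (\<Sum>k. ennreal (z ^ k * (exp (- r) * r ^ k / fact k)))"
    using assms(3,4)
    by (intro suminf_cong, subst nn_integral_cmult_indicator)
      (simp_all add: emeasure_eq_measure N flip: ennreal_mult)
  also have "\<dots> = ennreal (exp (r * (z - 1)))"
  proof (rule suminf_ennreal_eq)
    have "(\<lambda>k. exp (- r) * ((r * z) ^ k /\<^sub>R fact k)) sums (exp (- r) * exp (r * z))"
      by (intro sums_mult exp_converges)
    then show "(\<lambda>k. z ^ k * (exp (- r) * r ^ k / fact k)) sums exp (r * (z - 1))"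
      by (simp add: field_simps power_mult_distrib flip: exp_add)
  qed (use assms in auto)
  finally show ?thesis .
qed

lemma (in prob_space) poisson_exp_moment:
  assumes [measurable]: "N \<in> measurable M (count_space UNIV)"
    and N: "\<And>k. prob {\<omega> \<in> space M. N \<omega> = k} = exp (- r) * r ^ k / fact k" and "0 \<le> r"
  shows "integrable M (\<lambda>\<omega>. exp (c * real (N \<omega>)))"
proof (rule integrableI_nonneg)
  have "(\<integral>\<^sup>+\<omega>. ennreal (exp c ^ N \<omega>) \<partial>M) = ennreal (exp (r * (exp c - 1)))"
    using assms by (intro poisson_pgf) auto
  then show "(\<integral>\<^sup>+\<omega>. ennreal (exp (c * real (N \<omega>))) \<partial>M) < \<infinity>"
    by (simp add: mult.commute flip: exp_of_nat_mult)
qed auto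

section \<open>Negative binomial processes\<close>

lemma (in prob_space) AE_NB_law_in_Nats:
  assumes "has_NB_law M X r p" "0 < p" "p < 1"
  shows "AE \<omega> in M. X \<omega> \<in> \<nat>"
proof (rule AE_in_Nats)
  have "(\<lambda>k. prob {\<omega> \<in> space M. X \<omega> = real k}) = nb_mass p r"
    using assms(1) by (auto simp: has_NB_law_def nb_mass_def)
  then show "(\<lambda>k. prob {\<omega> \<in> space M. X \<omega> = real k}) sums 1"
    using nb_mass_sums_1[OF assms(2,3)] by simp
qed (use assms in \<open>simp add: has_NB_law_def\<close>)

lemma (in prob_space) NB_law_pgf:
  assumes law: "has_NB_law M X r p" and p: "0 < p" "p < 1" and x: "0 < x" "x < 1"
  shows "expectation (\<lambda>\<omega>. x powr X \<omega>) = (p / (1 - (1 - p) * x)) powr r"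
proof -
  have [measurable]: "X \<in> borel_measurable M"
    using law by (simp add: has_NB_law_def)
  have "expectation (\<lambda>\<omega>. (if X \<omega> = real k then 1 else 0) * 1) = nb_mass p r k" for k :: nat
  proof -
    have "expectation (\<lambda>\<omega>. (if X \<omega> = real k then 1 else 0) * 1 :: real)
        = expectation (indicator {\<omega> \<in> space M. X \<omega> = real k})"
      by (intro Bochner_Integration.integral_cong) auto
    then show ?thesis
      using law by (simp add: has_NB_law_def nb_mass_def)
  qed
  moreover have "(\<lambda>k. expectation (\<lambda>\<omega>. (if X \<omega> = real k then 1 else 0) * 1) * x ^ k)
      sums expectation (\<lambda>\<omega>. x powr X \<omega> * 1)"
    by (rule weights_expectation_sums[OF weights_with_pgf_indicator[OF _ AE_NB_law_in_Nats[OF law p]]])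
      (use x in auto)
  ultimately have "(\<lambda>k. nb_mass p r k * x ^ k) sums expectation (\<lambda>\<omega>. x powr X \<omega>)"
    by simp
  then show ?thesis
    using nb_mass_pgf[OF p, of x r] x by (auto intro: sums_unique2)
qed

lemma (in prob_space) NB_process_value:
  assumes "NB_process M \<mu> p K" "\<mu> 0 = 0" "0 < p" "p < 1" "0 \<le> u"
  shows "AE \<omega> in M. K u \<omega> \<in> \<nat>"
proof -
  have "has_NB_law M (\<lambda>\<omega>. K u \<omega> - K 0 \<omega>) (\<mu> u - \<mu> 0) p"
    using assms(1,5) unfolding NB_process_def by blast
  then have "AE \<omega> in M. K u \<omega> - K 0 \<omega> \<in> \<nat>"
    using assms(3,4) by (rule AE_NB_law_in_Nats)
  moreover have "AE \<omega> in M. K 0 \<omega> = 0"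
    using assms by (auto simp: NB_process_def)
  ultimately show ?thesis by eventually_elim simp
qed

text \<open>The increments over \<open>(0, u]\<close> and \<open>(u, w]\<close> are independent, and the first is almost surely \<open>K u\<close>.\<close>

lemma (in prob_space) NB_process_pgf:
  assumes K: "NB_process M \<mu> p K" and \<mu>: "\<mu> 0 = 0" and p: "0 < p" "p < 1" and u: "0 \<le> u" "u \<le> w"
    and xy: "0 < x" "x < 1" "0 < y" "y < 1"
  shows "expectation (\<lambda>\<omega>. x powr K u \<omega> * y powr (K w \<omega> - K u \<omega>))
    = (p / (1 - (1 - p) * x)) powr \<mu> u * (p / (1 - (1 - p) * y)) powr (\<mu> w - \<mu> u)"
proof -
  \<comment> \<open>independence of increments is available along a sequence of times only, hence the constant tail\<close>
  define times where "times i = (if i = 0 then 0 else if i = 1 then u else w)" for i :: nat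
  define z where "z i = (if i = 0 then x else y)" for i :: nat
  define D where "D i \<omega> = K (times (Suc i)) \<omega> - K (times i) \<omega>" for i \<omega>
  have [measurable]: "K v \<in> borel_measurable M" for v
    using K by (simp add: NB_process_def)
  have law: "has_NB_law M (D i) (\<mu> (times (Suc i)) - \<mu> (times i)) p" for i
    using K u unfolding NB_process_def D_def by (auto simp: times_def)
  have [measurable]: "D i \<in> borel_measurable M" for i
    unfolding D_def by measurable
  have "indep_vars (\<lambda>_. borel) D {..<2}"
  proof -
    have "0 \<le> times 0 \<and> mono times"
      using u by (auto simp: times_def mono_def)
    then show ?thesis
      using K unfolding NB_process_def D_def by blast
  qed
  then have indep: "indep_vars (\<lambda>_. borel) (\<lambda>i \<omega>. z i powr D i \<omega>) {..<2}"
    by (rule indep_vars_compose2) auto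
  have "expectation (\<lambda>\<omega>. \<Prod>i<2. z i powr D i \<omega>) = (\<Prod>i<2. expectation (\<lambda>\<omega>. z i powr D i \<omega>))"
  proof (rule indep_vars_lebesgue_integral[OF _ indep])
    fix i :: nat
    have "AE \<omega> in M. D i \<omega> \<in> \<nat>"
      by (rule AE_NB_law_in_Nats[OF law p])
    then have "AE \<omega> in M. norm (z i powr D i \<omega>) \<le> 1"
    proof eventually_elim
      fix \<omega> assume "D i \<omega> \<in> \<nat>"
      then have "0 \<le> D i \<omega>" by (auto elim: Nats_cases)
      then show "norm (z i powr D i \<omega>) \<le> 1"
        using xy by (auto simp: z_def powr_le1)
    qed
    then show "integrable M (\<lambda>\<omega>. z i powr D i \<omega>)"
      by (rule integrable_const_bound) simp
  qed simp
  also have "(\<Prod>i<2. expectation (\<lambda>\<omega>. z i powr D i \<omega>))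
      = (p / (1 - (1 - p) * x)) powr \<mu> u * (p / (1 - (1 - p) * y)) powr (\<mu> w - \<mu> u)"
    using NB_law_pgf[OF law[of 0] p xy(1,2)] NB_law_pgf[OF law[of 1] p xy(3,4)]
    by (simp add: numeral_2_eq_2 z_def times_def \<mu>)
  also have "expectation (\<lambda>\<omega>. \<Prod>i<2. z i powr D i \<omega>)
      = expectation (\<lambda>\<omega>. x powr K u \<omega> * y powr (K w \<omega> - K u \<omega>))"
  proof (rule integral_cong_AE)
    have "AE \<omega> in M. K 0 \<omega> = 0"
      using K by (auto simp: NB_process_def)
    then show "AE \<omega> in M. (\<Prod>i<2. z i powr D i \<omega>) = x powr K u \<omega> * y powr (K w \<omega> - K u \<omega>)"
      by eventually_elim (simp add: numeral_2_eq_2 z_def D_def times_def)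
  qed measurable
  finally show ?thesis .
qed

section \<open>The generating function of the cluster process\<close>

locale nb_cluster_model = prob_space P for P :: "'a measure" +
  fixes \<Lambda> :: "real measure" and T :: "nat \<Rightarrow> 'a \<Rightarrow> ereal" and L :: "nat \<Rightarrow> real \<Rightarrow> 'a \<Rightarrow> real"
    and V :: "nat \<Rightarrow> 'a \<Rightarrow> real" and \<mu> :: "real \<Rightarrow> real" and p s t :: real
  assumes mass_pos: "measure \<Lambda> {0..1} > 0"
    and poisson: "poisson_process P \<Lambda> T"
    and \<mu>_continuous: "continuous_on {0..} \<mu>" and \<mu>_mono: "mono_on {0..} \<mu>" and \<mu>_0: "\<mu> 0 = 0"
    and p: "0 < p" "p < 1"
    and clusters: "iid_NB_clusters P \<mu> p L"
    and points_indep_clusters: "indep_elements P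
           (PiM UNIV (\<lambda>_. borel)) (\<lambda>\<omega> j. T j \<omega>)
           (PiM UNIV (\<lambda>_. PiM UNIV (\<lambda>_. borel))) (\<lambda>\<omega> j u. L j u \<omega>)"
    and normalized: "iid_normalized P \<Lambda> V"
    and points_indep_normalized: "indep_elements P
           (PiM UNIV (\<lambda>_. borel)) (\<lambda>\<omega> j. T j \<omega>) (PiM UNIV (\<lambda>_. borel)) (\<lambda>\<omega> j. V j \<omega>)"
    and t: "t \<ge> 1" and s: "s > 0"
begin

definition N :: "'a \<Rightarrow> nat" where
  "N = num_points T {0..1}"

abbreviation total_mass :: real where
  "total_mass \<equiv> measure \<Lambda> {0..1}"

abbreviation pgf_base :: "real \<Rightarrow> real" where
  "pgf_base x \<equiv> p / (1 - (1 - p) * x)"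

text \<open>\<open>\<mu>\<close> is prescribed on \<open>{0..}\<close> only; the extension by \<open>\<mu> 0\<close> is continuous on the whole line.\<close>

definition clock :: "real \<Rightarrow> real" where
  "clock u = \<mu> (max 0 u)"

text \<open>
  The joint generating function of the value at time \<open>t\<close> and the increment over \<open>(t, t + s]\<close> of a
  cluster that starts at \<open>v\<close>.
\<close>

definition cluster_pgf :: "real \<Rightarrow> real \<Rightarrow> real \<Rightarrow> real" where
  "cluster_pgf x y v = pgf_base x powr clock (t - v) * pgf_base y powr (clock (t + s - v) - clock (t - v))"

definition grid_cluster_sum :: "nat \<Rightarrow> real \<Rightarrow> 'a \<Rightarrow> real" where
  "grid_cluster_sum n u \<omega> = (\<Sum>j<N \<omega>. L j (u - grid n (cell n (real_of_ereal (T j \<omega>)))) \<omega>)"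

lemma points_measurable [measurable]: "T j \<in> borel_measurable P"
  using poisson by (simp add: poisson_process_def point_sequence_def)

lemma cluster_measurable [measurable]: "L j u \<in> borel_measurable P"
  using clusters by (simp add: iid_NB_clusters_def NB_process_def)

lemma V_measurable [measurable]: "V j \<in> borel_measurable P"
proof -
  have "indep_vars (\<lambda>_. borel) V UNIV"
    using normalized by (simp add: iid_normalized_def)
  then show ?thesis
    by (simp add: indep_vars_def2)
qed

lemma V_range: "\<omega> \<in> space P \<Longrightarrow> V j \<omega> \<in> {0..1}"
  using normalized by (simp add: iid_normalized_def)

lemma num_points_measurable:
  assumes "B \<in> sets borel" "bounded B" "B \<subseteq> {0..}"
  shows "num_points T B \<in> measurable P (count_space UNIV)"
proof -
  have "indep_vars (\<lambda>_. count_space UNIV) (\<lambda>i::nat. num_points T B) {..<1}"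
    using poisson assms unfolding poisson_process_def
    by (elim conjE allE[of _ "1::nat"] allE[of _ "\<lambda>_::nat. B"]) (auto simp: disjoint_family_on_def)
  then show ?thesis
    by (simp add: indep_vars_def2 lessThan_Suc)
qed

lemma N_measurable [measurable]: "N \<in> measurable P (count_space UNIV)"
  unfolding N_def by (rule num_points_measurable) auto

lemma N_law: "prob {\<omega> \<in> space P. N \<omega> = k} = exp (- total_mass) * total_mass ^ k / fact k"
  using poisson unfolding N_def poisson_process_def by auto

lemma N_exp_moment: "integrable P (\<lambda>\<omega>. exp (r * real (N \<omega>)))"
  by (rule poisson_exp_moment[OF N_measurable N_law]) simp

lemma AE_points:
  "AE \<omega> in P. {j. T j \<omega> \<in> ereal ` {0..1}} = {..<N \<omega>} \<and> N \<omega> = exit_index (\<lambda>j. T j \<omega>)"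
proof -
  have "point_sequence P T"
    using poisson by (simp add: poisson_process_def)
  from AE_points_in_unit_interval[OF this] show ?thesis
    by eventually_elim (simp add: N_def num_points_def)
qed

lemma AE_points_range: "AE \<omega> in P. \<forall>j<N \<omega>. real_of_ereal (T j \<omega>) \<in> {0..1}"
  using AE_points
proof eventually_elim
  fix \<omega> assume \<omega>: "{j. T j \<omega> \<in> ereal ` {0..1}} = {..<N \<omega>} \<and> N \<omega> = exit_index (\<lambda>j. T j \<omega>)"
  show "\<forall>j<N \<omega>. real_of_ereal (T j \<omega>) \<in> {0..1}"
  proof (intro allI impI)
    fix j assume "j < N \<omega>"
    then have "j \<in> {j. T j \<omega> \<in> ereal ` {0..1}}" using \<omega> by blast
    then show "real_of_ereal (T j \<omega>) \<in> {0..1}" by auto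
  qed
qed

lemma clock_continuous: "continuous_on UNIV clock"
  unfolding clock_def
  by (rule continuous_on_compose2[OF \<mu>_continuous]) (auto intro!: continuous_intros)

lemma clock_measurable [measurable]: "clock \<in> borel_measurable borel"
  by (rule borel_measurable_continuous_onI[OF clock_continuous])

lemma clock_mono: "u \<le> w \<Longrightarrow> clock u \<le> clock w"
  unfolding clock_def by (rule mono_onD[OF \<mu>_mono]) auto

lemma clock_nonneg: "0 \<le> clock u"
  unfolding clock_def using mono_onD[OF \<mu>_mono, of 0 "max 0 u"] \<mu>_0 by simp

context
  fixes x y :: real
  assumes xy: "0 < x" "x < 1" "0 < y" "y < 1"
begin

lemma cluster_pgf_range: "0 \<le> cluster_pgf x y v" "cluster_pgf x y v \<le> 1"
proof -
  have "\<bar>pgf_base z\<bar> \<le> 1" "0 \<le> pgf_base z" if "z \<in> {x, y}" for z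
  proof -
    have "0 < pgf_base z" "pgf_base z \<le> 1"
      using pgf_base_bounds[OF p, of z] xy that by auto
    then show "\<bar>pgf_base z\<bar> \<le> 1" "0 \<le> pgf_base z"
      by linarith+
  qed
  moreover have "0 \<le> clock (t - v)" "0 \<le> clock (t + s - v) - clock (t - v)"
    using clock_nonneg clock_mono[of "t - v" "t + s - v"] s by auto
  ultimately show "cluster_pgf x y v \<le> 1"
    unfolding cluster_pgf_def by (intro mult_le_one powr_le1) auto
qed (simp add: cluster_pgf_def)

lemma cluster_pgf_continuous: "continuous_on UNIV (cluster_pgf x y)"
proof -
  have "pgf_base x \<noteq> 0" "pgf_base y \<noteq> 0"
    using pgf_base_bounds(1)[OF p, of x] pgf_base_bounds(1)[OF p, of y] xy by auto
  moreover have "continuous_on UNIV (\<lambda>v. clock (u - v))" for u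
    by (rule continuous_on_compose2[OF clock_continuous]) (auto intro!: continuous_intros)
  ultimately show ?thesis
    unfolding cluster_pgf_def by (intro continuous_intros) auto
qed

lemma cluster_pgf_measurable [measurable]: "cluster_pgf x y \<in> borel_measurable borel"
  by (rule borel_measurable_continuous_onI[OF cluster_pgf_continuous])

end

lemma AE_cluster_values:
  "AE \<omega> in P. \<forall>j n i. i \<le> int (Suc n) \<longrightarrow>
     L j (t - grid n i) \<omega> \<in> \<nat> \<and> L j (t + s - grid n i) \<omega> - L j (t - grid n i) \<omega> \<in> \<nat>"
proof (intro AE_all_countable[THEN iffD2] allI)
  fix j n i
  have L: "NB_process P \<mu> p (L j)"
    using clusters by (simp add: iid_NB_clusters_def)
  show "AE \<omega> in P. i \<le> int (Suc n) \<longrightarrow>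
     L j (t - grid n i) \<omega> \<in> \<nat> \<and> L j (t + s - grid n i) \<omega> - L j (t - grid n i) \<omega> \<in> \<nat>"
  proof (cases "i \<le> int (Suc n)")
    case True
    then have u: "0 \<le> t - grid n i" using grid_le_1[of i n] t by simp
    have "has_NB_law P (\<lambda>\<omega>. L j (t + s - grid n i) \<omega> - L j (t - grid n i) \<omega>)
        (\<mu> (t + s - grid n i) - \<mu> (t - grid n i)) p"
      using L u s unfolding NB_process_def by auto
    from AE_NB_law_in_Nats[OF this p] NB_process_value[OF L \<mu>_0 p u] show ?thesis
      by eventually_elim simp
  qed simp
qed

lemma grid_cluster_sum_measurable [measurable]: "grid_cluster_sum n u \<in> borel_measurable P"
proof -
  have [measurable]: "(\<lambda>\<omega>. L j (u - grid n (cell n (real_of_ereal (T j \<omega>)))) \<omega>) \<in> borel_measurable P" for j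
    by (rule measurable_compose_countable[where f = "\<lambda>i \<omega>. L j (u - grid n i) \<omega>"]) measurable
  show ?thesis
    unfolding grid_cluster_sum_def
    by (rule measurable_compose_countable[where f = "\<lambda>k \<omega>. \<Sum>j<k. L j (u - grid n (cell n (real_of_ereal (T j \<omega>)))) \<omega>"])
      measurable
qed

text \<open>This is where right-continuity of the paths is used.\<close>

lemma grid_cluster_sum_tendsto:
  assumes "\<omega> \<in> space P"
  shows "(\<lambda>n. grid_cluster_sum n u \<omega>) \<longlonglongrightarrow> cluster_model T L u \<omega>"
  unfolding grid_cluster_sum_def cluster_model_def N_def
proof (rule tendsto_sum)
  fix j
  define v where "v = real_of_ereal (T j \<omega>)"
  have "continuous (at_right (u - v)) (\<lambda>w. L j w \<omega>)"
    using clusters assms by (simp add: iid_NB_clusters_def NB_process_def)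
  then have right: "((\<lambda>w. L j w \<omega>) \<longlongrightarrow> L j (u - v) \<omega>) (at_right (u - v))"
    by (simp add: continuous_within)
  have "filterlim (\<lambda>n. u - grid n (cell n v)) (at_right (u - v)) sequentially"
  proof (rule tendsto_imp_filterlim_at_right)
    show "(\<lambda>n. u - grid n (cell n v)) \<longlonglongrightarrow> u - v"
      by (intro tendsto_diff tendsto_const grid_cell_tendsto)
    show "\<forall>\<^sub>F n in sequentially. u - v < u - grid n (cell n v)"
      using grid_cell_less[of _ v] by (intro always_eventually) auto
  qed
  from filterlim_compose[OF right this]
  show "(\<lambda>n. L j (u - grid n (cell n (real_of_ereal (T j \<omega>)))) \<omega>) \<longlonglongrightarrow> L j (u - real_of_ereal (T j \<omega>)) \<omega>"
    by (simp add: v_def)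
qed

lemma cluster_model_measurable [measurable]: "cluster_model T L u \<in> borel_measurable P"
  by (rule borel_measurable_LIMSEQ_real[of P "\<lambda>n. grid_cluster_sum n u"]) (auto intro: grid_cluster_sum_tendsto)

lemma sum_in_Nats: "(\<And>i. i \<in> A \<Longrightarrow> f i \<in> \<nat>) \<Longrightarrow> sum f A \<in> (\<nat> :: real set)"
  by (induction A rule: infinite_finite_induct) auto

lemma AE_grid_cluster_sum_values:
  "AE \<omega> in P. \<forall>n. grid_cluster_sum n t \<omega> \<in> \<nat> \<and> grid_cluster_sum n (t + s) \<omega> - grid_cluster_sum n t \<omega> \<in> \<nat>"
  using AE_cluster_values AE_points_range
proof eventually_elim
  fix \<omega>
  assume L: "\<forall>j n i. i \<le> int (Suc n) \<longrightarrow>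
     L j (t - grid n i) \<omega> \<in> \<nat> \<and> L j (t + s - grid n i) \<omega> - L j (t - grid n i) \<omega> \<in> \<nat>"
    and T: "\<forall>j<N \<omega>. real_of_ereal (T j \<omega>) \<in> {0..1}"
  have "cell n (real_of_ereal (T j \<omega>)) \<le> int (Suc n)" if "j < N \<omega>" for j n
    using T that cell_range[of "real_of_ereal (T j \<omega>)" n] by (simp del: of_nat_Suc)
  then show "\<forall>n. grid_cluster_sum n t \<omega> \<in> \<nat> \<and> grid_cluster_sum n (t + s) \<omega> - grid_cluster_sum n t \<omega> \<in> \<nat>"
    unfolding grid_cluster_sum_def sum_subtractf[symmetric]
    using L by (intro allI conjI sum_in_Nats) (auto simp del: of_nat_Suc)
qed

lemma AE_cluster_model_values:
  "AE \<omega> in P. cluster_model T L t \<omega> \<in> \<nat> \<and> cluster_model T L (t + s) \<omega> - cluster_model T L t \<omega> \<in> \<nat>"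
  using AE_grid_cluster_sum_values AE_space
proof eventually_elim
  fix \<omega>
  assume vals: "\<forall>n. grid_cluster_sum n t \<omega> \<in> \<nat> \<and> grid_cluster_sum n (t + s) \<omega> - grid_cluster_sum n t \<omega> \<in> \<nat>"
    and \<omega>: "\<omega> \<in> space P"
  have "cluster_model T L t \<omega> \<in> \<nat>"
    by (rule closed_sequentially[OF closed_Nats _ grid_cluster_sum_tendsto[OF \<omega>]]) (use vals in auto)
  moreover have "cluster_model T L (t + s) \<omega> - cluster_model T L t \<omega> \<in> \<nat>"
    by (rule closed_sequentially[OF closed_Nats _
        tendsto_diff[OF grid_cluster_sum_tendsto[OF \<omega>] grid_cluster_sum_tendsto[OF \<omega>]]]) (use vals in auto)
  ultimately show "cluster_model T L t \<omega> \<in> \<nat> \<and> cluster_model T L (t + s) \<omega> - cluster_model T L t \<omega> \<in> \<nat>" ..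
qed

context
  fixes x y :: real
  assumes xy: "0 < x" "x < 1" "0 < y" "y < 1"
begin

lemma nats_pgf_le_1: "a \<in> \<nat> \<Longrightarrow> b \<in> \<nat> \<Longrightarrow> x powr a * y powr b \<le> 1"
  using xy by (intro mult_le_one powr_le1) (auto elim!: Nats_cases)

lemma single_cluster_pgf:
  assumes "i \<le> int (Suc n)"
  shows "(\<integral>\<^sup>+\<omega>. ennreal (x powr L j (t - grid n i) \<omega> * y powr (L j (t + s - grid n i) \<omega> - L j (t - grid n i) \<omega>)) \<partial>P)
    = ennreal (cluster_pgf x y (grid n i))"
proof -
  have u: "0 \<le> t - grid n i" using grid_le_1[OF assms] t by simp
  have "AE \<omega> in P. norm (x powr L j (t - grid n i) \<omega> * y powr (L j (t + s - grid n i) \<omega> - L j (t - grid n i) \<omega>)) \<le> 1"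
    using AE_cluster_values
  proof eventually_elim
    fix \<omega>
    assume "\<forall>j n i. i \<le> int (Suc n) \<longrightarrow>
      L j (t - grid n i) \<omega> \<in> \<nat> \<and> L j (t + s - grid n i) \<omega> - L j (t - grid n i) \<omega> \<in> \<nat>"
    then show "norm (x powr L j (t - grid n i) \<omega> * y powr (L j (t + s - grid n i) \<omega> - L j (t - grid n i) \<omega>)) \<le> 1"
      using assms nats_pgf_le_1 by simp
  qed
  then have "integrable P (\<lambda>\<omega>. x powr L j (t - grid n i) \<omega> * y powr (L j (t + s - grid n i) \<omega> - L j (t - grid n i) \<omega>))"
    by (rule integrable_const_bound) measurable
  then have "(\<integral>\<^sup>+\<omega>. ennreal (x powr L j (t - grid n i) \<omega> * y powr (L j (t + s - grid n i) \<omega> - L j (t - grid n i) \<omega>)) \<partial>P)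
      = ennreal (expectation (\<lambda>\<omega>. x powr L j (t - grid n i) \<omega> * y powr (L j (t + s - grid n i) \<omega> - L j (t - grid n i) \<omega>)))"
    by (rule nn_integral_eq_integral) auto
  also have "expectation (\<lambda>\<omega>. x powr L j (t - grid n i) \<omega> * y powr (L j (t + s - grid n i) \<omega> - L j (t - grid n i) \<omega>))
      = cluster_pgf x y (grid n i)"
  proof -
    have "NB_process P \<mu> p (L j)" "t - grid n i \<le> t + s - grid n i"
      using clusters s by (auto simp: iid_NB_clusters_def)
    then show ?thesis
      using NB_process_pgf[of \<mu> p "L j" "t - grid n i" "t + s - grid n i" x y] \<mu>_0 p u s xy
      unfolding cluster_pgf_def clock_def by simp
  qed
  finally show ?thesis .
qed

text \<open>
  Conditioning on the points. Only countably many times occur in the discretised sum, so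
  the integrand is jointly measurable and the product measure can be used; the evaluation
  \<open>(u, l) \<mapsto> l u\<close> itself is not measurable for the product \<open>\<sigma>\<close>-algebra on paths.
\<close>

lemma grid_pgf_given_points:
  "(\<integral>\<^sup>+\<omega>. ennreal (x powr grid_cluster_sum n t \<omega> * y powr (grid_cluster_sum n (t + s) \<omega> - grid_cluster_sum n t \<omega>)) \<partial>P)
   = (\<integral>\<^sup>+\<omega>. ennreal (\<Prod>j<N \<omega>. cluster_pgf x y (grid n (cell n (real_of_ereal (T j \<omega>))))) \<partial>P)"
proof -
  define z where "z l i = ennreal (x powr l (t - grid n i) * y powr (l (t + s - grid n i) - l (t - grid n i)))"
    for l :: "real \<Rightarrow> real" and i
  define f where "f = (\<lambda>(\<tau>, l). \<Prod>j<exit_index \<tau>. z (l j) (cell n (real_of_ereal (\<tau> j))))"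
  let ?S = "PiM UNIV (\<lambda>_::nat. borel :: ereal measure)"
  let ?S' = "PiM UNIV (\<lambda>_::nat. PiM UNIV (\<lambda>_::real. borel :: real measure))"
  have [measurable]: "(\<lambda>l. z l i) \<in> borel_measurable (PiM UNIV (\<lambda>_::real. borel))" for i
    unfolding z_def by measurable
  have [measurable]: "(\<lambda>a. z (snd a j) (cell n (real_of_ereal (fst a j)))) \<in> borel_measurable (?S \<Otimes>\<^sub>M ?S')" for j
  proof (rule measurable_compose_countable[where f = "\<lambda>i a. z (snd a j) i"])
    show "(\<lambda>a. z (snd a j) i) \<in> borel_measurable (?S \<Otimes>\<^sub>M ?S')" for i
      by measurable
  qed measurable
  have f: "f \<in> borel_measurable (?S \<Otimes>\<^sub>M ?S')"
    unfolding f_def case_prod_beta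
    by (rule measurable_compose_countable[where f = "\<lambda>k a. \<Prod>j<k. z (snd a j) (cell n (real_of_ereal (fst a j)))"])
      measurable
  have "(\<integral>\<^sup>+\<omega>. ennreal (x powr grid_cluster_sum n t \<omega> * y powr (grid_cluster_sum n (t + s) \<omega> - grid_cluster_sum n t \<omega>)) \<partial>P)
      = (\<integral>\<^sup>+\<omega>. f (\<lambda>j. T j \<omega>, \<lambda>j u. L j u \<omega>) \<partial>P)"
  proof (rule nn_integral_cong_AE)
    show "AE \<omega> in P. ennreal (x powr grid_cluster_sum n t \<omega> * y powr (grid_cluster_sum n (t + s) \<omega> - grid_cluster_sum n t \<omega>))
        = f (\<lambda>j. T j \<omega>, \<lambda>j u. L j u \<omega>)"
      using AE_points
    proof eventually_elim
      fix \<omega> assume "{j. T j \<omega> \<in> ereal ` {0..1}} = {..<N \<omega>} \<and> N \<omega> = exit_index (\<lambda>j. T j \<omega>)"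
      then have "exit_index (\<lambda>j. T j \<omega>) = N \<omega>" by simp
      then show "ennreal (x powr grid_cluster_sum n t \<omega> * y powr (grid_cluster_sum n (t + s) \<omega> - grid_cluster_sum n t \<omega>))
          = f (\<lambda>j. T j \<omega>, \<lambda>j u. L j u \<omega>)"
        using xy unfolding f_def z_def grid_cluster_sum_def sum_subtractf[symmetric]
        by (simp add: powr_sum prod_ennreal flip: prod.distrib)
    qed
  qed
  also have "\<dots> = (\<integral>\<^sup>+\<omega>. (\<integral>\<^sup>+\<omega>'. f (\<lambda>j. T j \<omega>, \<lambda>j u. L j u \<omega>') \<partial>P) \<partial>P)"
    by (rule indep_elements_nn_integral[OF prob_space_axioms points_indep_clusters f])
  also have "\<dots> = (\<integral>\<^sup>+\<omega>. ennreal (\<Prod>j<N \<omega>. cluster_pgf x y (grid n (cell n (real_of_ereal (T j \<omega>))))) \<partial>P)"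
  proof (rule nn_integral_cong_AE)
    show "AE \<omega> in P. (\<integral>\<^sup>+\<omega>'. f (\<lambda>j. T j \<omega>, \<lambda>j u. L j u \<omega>') \<partial>P)
        = ennreal (\<Prod>j<N \<omega>. cluster_pgf x y (grid n (cell n (real_of_ereal (T j \<omega>)))))"
      using AE_points AE_points_range
    proof eventually_elim
      fix \<omega> assume "{j. T j \<omega> \<in> ereal ` {0..1}} = {..<N \<omega>} \<and> N \<omega> = exit_index (\<lambda>j. T j \<omega>)"
        and T: "\<forall>j<N \<omega>. real_of_ereal (T j \<omega>) \<in> {0..1}"
      then have N: "exit_index (\<lambda>j. T j \<omega>) = N \<omega>" by simp
      let ?i = "\<lambda>j. cell n (real_of_ereal (T j \<omega>))"
      have "indep_vars (\<lambda>_. PiM UNIV (\<lambda>_. borel)) (\<lambda>j \<omega> u. L j u \<omega>) {..<N \<omega>}"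
        using clusters by (auto simp: iid_NB_clusters_def intro: indep_vars_subset)
      then have indep: "indep_vars (\<lambda>_. borel) (\<lambda>j \<omega>'. z (\<lambda>u. L j u \<omega>') (?i j)) {..<N \<omega>}"
        by (rule indep_vars_compose2) measurable
      have "(\<integral>\<^sup>+\<omega>'. f (\<lambda>j. T j \<omega>, \<lambda>j u. L j u \<omega>') \<partial>P) = (\<integral>\<^sup>+\<omega>'. (\<Prod>j<N \<omega>. z (\<lambda>u. L j u \<omega>') (?i j)) \<partial>P)"
        by (simp add: f_def N)
      also have "\<dots> = (\<Prod>j<N \<omega>. \<integral>\<^sup>+\<omega>'. z (\<lambda>u. L j u \<omega>') (?i j) \<partial>P)"
        by (rule indep_vars_nn_integral[OF _ indep]) auto
      also have "\<dots> = (\<Prod>j<N \<omega>. ennreal (cluster_pgf x y (grid n (?i j))))"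
      proof (rule prod.cong[OF refl])
        fix j assume "j \<in> {..<N \<omega>}"
        then have "?i j \<le> int (Suc n)"
          using T cell_range[of "real_of_ereal (T j \<omega>)" n] by (simp del: of_nat_Suc)
        from single_cluster_pgf[OF this] show "(\<integral>\<^sup>+\<omega>'. z (\<lambda>u. L j u \<omega>') (?i j) \<partial>P) = ennreal (cluster_pgf x y (grid n (?i j)))"
          by (simp add: z_def)
      qed
      also have "\<dots> = ennreal (\<Prod>j<N \<omega>. cluster_pgf x y (grid n (?i j)))"
        using cluster_pgf_range[OF xy] by (intro prod_ennreal) auto
      finally show "(\<integral>\<^sup>+\<omega>'. f (\<lambda>j. T j \<omega>, \<lambda>j u. L j u \<omega>') \<partial>P)
        = ennreal (\<Prod>j<N \<omega>. cluster_pgf x y (grid n (cell n (real_of_ereal (T j \<omega>)))))" .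
    qed
  qed
  finally show ?thesis .
qed

end

lemma V_law: "prob {\<omega> \<in> space P. V j \<omega> \<in> B} = measure \<Lambda> (B \<inter> {0..1}) / total_mass" if "B \<in> sets borel"
  using normalized that unfolding iid_normalized_def by blast

lemma V_identically_distributed: "distr P borel (V j) = distr P borel (V 0)"
proof (rule measure_eqI)
  fix B assume "B \<in> sets (distr P borel (V j))"
  then have B: "B \<in> sets borel" by simp
  have "V i -` B \<inter> space P = {\<omega> \<in> space P. V i \<omega> \<in> B}" for i by auto
  then show "emeasure (distr P borel (V j)) B = emeasure (distr P borel (V 0)) B"
    using B V_law[OF B, of j] V_law[OF B, of 0] by (simp add: emeasure_distr emeasure_eq_measure)
qed simp

text \<open>
  \<open>V 0\<close> has law \<open>\<Lambda>\<close> normalised on the unit interval, so the sums over the cells are expectations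
  of functions of \<open>V 0\<close>.
\<close>

lemma sum_measure_cells:
  "(\<Sum>i<Suc (Suc n). measure \<Lambda> {v \<in> {0..1}. cell n v = int i} * h (int i))
    = total_mass * expectation (\<lambda>\<omega>. h (cell n (V 0 \<omega>)))"
proof -
  define C where "C i = {v :: real. cell n v = int i}" for i
  have [measurable]: "C i \<in> sets borel" for i
    unfolding C_def by measurable
  have "expectation (\<lambda>\<omega>. h (cell n (V 0 \<omega>)))
      = expectation (\<lambda>\<omega>. \<Sum>i<Suc (Suc n). h (int i) * indicator {\<omega> \<in> space P. V 0 \<omega> \<in> C i} \<omega>)"
  proof (intro Bochner_Integration.integral_cong refl)
    fix \<omega> assume \<omega>: "\<omega> \<in> space P"
    define k where "k = nat (cell n (V 0 \<omega>))"
    have k: "k < Suc (Suc n)" "cell n (V 0 \<omega>) = int k"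
      using cell_range[OF V_range[OF \<omega>, of 0], of n] by (auto simp: k_def)
    have "(\<Sum>i<Suc (Suc n). h (int i) * indicator {\<omega> \<in> space P. V 0 \<omega> \<in> C i} \<omega>)
        = (\<Sum>i<Suc (Suc n). if i = k then h (int i) else 0)"
      using \<omega> k(2) by (intro sum.cong refl) (auto simp: C_def)
    then show "h (cell n (V 0 \<omega>)) = (\<Sum>i<Suc (Suc n). h (int i) * indicator {\<omega> \<in> space P. V 0 \<omega> \<in> C i} \<omega>)"
      using k by (simp del: sum.lessThan_Suc)
  qed
  also have "\<dots> = (\<Sum>i<Suc (Suc n). h (int i) * prob {\<omega> \<in> space P. V 0 \<omega> \<in> C i})"
  proof -
    have "integrable P (indicator {\<omega> \<in> space P. V 0 \<omega> \<in> C i} :: _ \<Rightarrow> real)" for i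
      by (rule integrable_real_indicator) (auto simp: emeasure_eq_measure)
    then show ?thesis
      by (subst Bochner_Integration.integral_sum) (simp_all del: sum.lessThan_Suc)
  qed
  also have "\<dots> = (\<Sum>i<Suc (Suc n). h (int i) * (measure \<Lambda> (C i \<inter> {0..1}) / total_mass))"
    by (simp only: V_law \<open>\<And>i. C i \<in> sets borel\<close>)
  finally have "total_mass * expectation (\<lambda>\<omega>. h (cell n (V 0 \<omega>)))
      = (\<Sum>i<Suc (Suc n). measure \<Lambda> (C i \<inter> {0..1}) * h (int i))"
    using mass_pos by (simp add: sum_distrib_left mult.commute del: sum.lessThan_Suc)
  moreover have "C i \<inter> {0..1} = {v \<in> {0..1}. cell n v = int i}" for i
    by (auto simp: C_def)
  ultimately show ?thesis by simp
qed

text \<open>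
  The numbers of points in the cells are independent Poisson variables, and the product over
  the points groups into one power for each cell.
\<close>

lemma grid_product_points:
  assumes h: "\<And>i. 0 \<le> h i"
  shows "(\<integral>\<^sup>+\<omega>. ennreal (\<Prod>j<N \<omega>. h (cell n (real_of_ereal (T j \<omega>)))) \<partial>P)
    = ennreal (exp (total_mass * (expectation (\<lambda>\<omega>. h (cell n (V 0 \<omega>))) - 1)))"
proof -
  define B where "B i = {v \<in> {0..1}. cell n v = int i}" for i
  let ?I = "{..<Suc (Suc n)}"
  have B: "B i \<in> sets borel" "bounded (B i)" "B i \<subseteq> {0..}" for i
  proof -
    have "B i = {0..1} \<inter> {v. cell n v = int i}" by (auto simp: B_def)
    then show "B i \<in> sets borel" by simp
    show "bounded (B i)"
      by (rule bounded_subset[of "{0..1}"]) (auto simp: B_def)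
  qed (auto simp: B_def)
  have [measurable]: "num_points T (B i) \<in> measurable P (count_space UNIV)" for i
    by (rule num_points_measurable[OF B])
  have "(\<integral>\<^sup>+\<omega>. ennreal (\<Prod>j<N \<omega>. h (cell n (real_of_ereal (T j \<omega>)))) \<partial>P)
      = (\<integral>\<^sup>+\<omega>. (\<Prod>i\<in>?I. ennreal (h (int i) ^ num_points T (B i) \<omega>)) \<partial>P)"
  proof (rule nn_integral_cong_AE)
    show "AE \<omega> in P. ennreal (\<Prod>j<N \<omega>. h (cell n (real_of_ereal (T j \<omega>))))
        = (\<Prod>i\<in>?I. ennreal (h (int i) ^ num_points T (B i) \<omega>))"
      using AE_points AE_points_range
    proof eventually_elim
      fix \<omega> assume points: "{j. T j \<omega> \<in> ereal ` {0..1}} = {..<N \<omega>} \<and> N \<omega> = exit_index (\<lambda>j. T j \<omega>)"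
        and T: "\<forall>j<N \<omega>. real_of_ereal (T j \<omega>) \<in> {0..1}"
      define c where "c j = nat (cell n (real_of_ereal (T j \<omega>)))" for j
      have c: "cell n (real_of_ereal (T j \<omega>)) = int (c j)" "c j \<in> ?I" if "j < N \<omega>" for j
        using T that cell_range[of "real_of_ereal (T j \<omega>)" n] by (auto simp: c_def)
      have count: "{j. T j \<omega> \<in> ereal ` B i} = {j \<in> {..<N \<omega>}. c j = i}" for i
      proof (intro set_eqI iffI)
        fix j assume "j \<in> {j. T j \<omega> \<in> ereal ` B i}"
        then obtain v where v: "T j \<omega> = ereal v" "v \<in> {0..1}" "cell n v = int i"
          by (auto simp: B_def)
        then have "j \<in> {..<N \<omega>}" using points by blast
        with v show "j \<in> {j \<in> {..<N \<omega>}. c j = i}" by (simp add: c_def)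
      next
        fix j assume j: "j \<in> {j \<in> {..<N \<omega>}. c j = i}"
        then have "T j \<omega> \<in> ereal ` {0..1}" using points by blast
        then obtain v where "T j \<omega> = ereal v" "v \<in> {0..1}" by blast
        with j c[of j] show "j \<in> {j. T j \<omega> \<in> ereal ` B i}" by (auto simp: B_def)
      qed
      have "(\<Prod>j<N \<omega>. h (cell n (real_of_ereal (T j \<omega>)))) = (\<Prod>j<N \<omega>. h (int (c j)))"
        using c by simp
      also have "\<dots> = (\<Prod>i\<in>?I. \<Prod>j\<in>{j \<in> {..<N \<omega>}. c j = i}. h (int (c j)))"
        using c by (intro prod.group[symmetric]) auto
      also have "\<dots> = (\<Prod>i\<in>?I. h (int i) ^ num_points T (B i) \<omega>)"
        unfolding num_points_def count by (intro prod.cong refl) simp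
      finally show "ennreal (\<Prod>j<N \<omega>. h (cell n (real_of_ereal (T j \<omega>))))
          = (\<Prod>i\<in>?I. ennreal (h (int i) ^ num_points T (B i) \<omega>))"
        using h by (simp add: prod_ennreal del: prod.lessThan_Suc)
    qed
  qed
  also have "\<dots> = (\<Prod>i\<in>?I. \<integral>\<^sup>+\<omega>. ennreal (h (int i) ^ num_points T (B i) \<omega>) \<partial>P)"
  proof (rule indep_vars_nn_integral)
    have "disjoint_family_on B ?I"
      by (auto simp: disjoint_family_on_def B_def)
    then have "indep_vars (\<lambda>_. count_space UNIV) (\<lambda>i. num_points T (B i)) ?I"
      using poisson B unfolding poisson_process_def
      by (elim conjE allE[of _ "Suc (Suc n)"] allE[of _ B]) simp
    then show "indep_vars (\<lambda>_. borel) (\<lambda>i \<omega>. ennreal (h (int i) ^ num_points T (B i) \<omega>)) ?I"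
      by (rule indep_vars_compose2) measurable
  qed auto
  also have "\<dots> = (\<Prod>i\<in>?I. ennreal (exp (measure \<Lambda> (B i) * (h (int i) - 1))))"
  proof (rule prod.cong[OF refl])
    fix i
    have "prob {\<omega> \<in> space P. num_points T (B i) \<omega> = k} = exp (- measure \<Lambda> (B i)) * measure \<Lambda> (B i) ^ k / fact k" for k
      using poisson B[of i] unfolding poisson_process_def by blast
    then show "(\<integral>\<^sup>+\<omega>. ennreal (h (int i) ^ num_points T (B i) \<omega>) \<partial>P) = ennreal (exp (measure \<Lambda> (B i) * (h (int i) - 1)))"
      using h by (intro poisson_pgf) auto
  qed
  also have "\<dots> = ennreal (exp (\<Sum>i\<in>?I. measure \<Lambda> (B i) * (h (int i) - 1)))"
    by (simp add: prod_ennreal exp_sum del: prod.lessThan_Suc sum.lessThan_Suc)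
  also have "(\<Sum>i\<in>?I. measure \<Lambda> (B i) * (h (int i) - 1))
      = total_mass * (expectation (\<lambda>\<omega>. h (cell n (V 0 \<omega>))) - 1)"
    using sum_measure_cells[of n h] sum_measure_cells[of n "\<lambda>_. 1"]
    by (simp add: B_def right_diff_distrib sum_subtractf prob_space del: sum.lessThan_Suc)
  finally show ?thesis .
qed

text \<open>
  Given the points, of which only the number matters, the factors are independent with the
  same mean; what remains is the generating function of a Poisson variable at that mean.
\<close>

lemma product_normalized_points:
  assumes [measurable]: "h \<in> borel_measurable borel" and h: "\<And>v. 0 \<le> h v" "\<And>v. h v \<le> 1"
  shows "(\<integral>\<^sup>+\<omega>. ennreal (\<Prod>j<N \<omega>. h (V j \<omega>)) \<partial>P)
    = ennreal (exp (total_mass * (expectation (\<lambda>\<omega>. h (V 0 \<omega>)) - 1)))"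
proof -
  let ?e = "expectation (\<lambda>\<omega>. h (V 0 \<omega>))"
  define f where "f = (\<lambda>(\<tau>, v). \<Prod>j<exit_index \<tau>. ennreal (h (v j)))"
  let ?S = "PiM UNIV (\<lambda>_::nat. borel :: ereal measure)"
  let ?S' = "PiM UNIV (\<lambda>_::nat. borel :: real measure)"
  have f: "f \<in> borel_measurable (?S \<Otimes>\<^sub>M ?S')"
    unfolding f_def case_prod_beta
    by (rule measurable_compose_countable[where f = "\<lambda>k a. \<Prod>j<k. ennreal (h (snd a j))"]) measurable
  have e: "0 \<le> ?e" using h by (intro integral_nonneg_AE AE_I2) auto
  have one: "(\<integral>\<^sup>+\<omega>. ennreal (h (V j \<omega>)) \<partial>P) = ennreal ?e" for j
  proof -
    have "(\<integral>\<^sup>+\<omega>. ennreal (h (V j \<omega>)) \<partial>P) = (\<integral>\<^sup>+v. ennreal (h v) \<partial>distr P borel (V j))"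
      by (simp add: nn_integral_distr)
    also have "\<dots> = (\<integral>\<^sup>+\<omega>. ennreal (h (V 0 \<omega>)) \<partial>P)"
      unfolding V_identically_distributed[of j] by (simp add: nn_integral_distr)
    also have "\<dots> = ennreal ?e"
      using h by (intro nn_integral_eq_integral integrable_const_bound[where B = 1] AE_I2) auto
    finally show ?thesis .
  qed
  have "(\<integral>\<^sup>+\<omega>. ennreal (\<Prod>j<N \<omega>. h (V j \<omega>)) \<partial>P) = (\<integral>\<^sup>+\<omega>. f (\<lambda>j. T j \<omega>, \<lambda>j. V j \<omega>) \<partial>P)"
  proof (rule nn_integral_cong_AE)
    show "AE \<omega> in P. ennreal (\<Prod>j<N \<omega>. h (V j \<omega>)) = f (\<lambda>j. T j \<omega>, \<lambda>j. V j \<omega>)"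
      using AE_points by eventually_elim (use h in \<open>auto simp: f_def prod_ennreal\<close>)
  qed
  also have "\<dots> = (\<integral>\<^sup>+\<omega>. (\<integral>\<^sup>+\<omega>'. f (\<lambda>j. T j \<omega>, \<lambda>j. V j \<omega>') \<partial>P) \<partial>P)"
    by (rule indep_elements_nn_integral[OF prob_space_axioms points_indep_normalized f])
  also have "\<dots> = (\<integral>\<^sup>+\<omega>. ennreal (?e ^ N \<omega>) \<partial>P)"
  proof (rule nn_integral_cong_AE)
    show "AE \<omega> in P. (\<integral>\<^sup>+\<omega>'. f (\<lambda>j. T j \<omega>, \<lambda>j. V j \<omega>') \<partial>P) = ennreal (?e ^ N \<omega>)"
      using AE_points
    proof eventually_elim
      fix \<omega> assume "{j. T j \<omega> \<in> ereal ` {0..1}} = {..<N \<omega>} \<and> N \<omega> = exit_index (\<lambda>j. T j \<omega>)"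
      then have N: "exit_index (\<lambda>j. T j \<omega>) = N \<omega>" by simp
      have "indep_vars (\<lambda>_. borel) V {..<N \<omega>}"
        using normalized by (auto simp: iid_normalized_def intro: indep_vars_subset)
      then have indep: "indep_vars (\<lambda>_. borel) (\<lambda>j \<omega>'. ennreal (h (V j \<omega>'))) {..<N \<omega>}"
        by (rule indep_vars_compose2) measurable
      have "(\<integral>\<^sup>+\<omega>'. f (\<lambda>j. T j \<omega>, \<lambda>j. V j \<omega>') \<partial>P) = (\<integral>\<^sup>+\<omega>'. (\<Prod>j<N \<omega>. ennreal (h (V j \<omega>'))) \<partial>P)"
        by (simp add: f_def N)
      also have "\<dots> = (\<Prod>j<N \<omega>. \<integral>\<^sup>+\<omega>'. ennreal (h (V j \<omega>')) \<partial>P)"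
        by (rule indep_vars_nn_integral[OF _ indep]) auto
      finally show "(\<integral>\<^sup>+\<omega>'. f (\<lambda>j. T j \<omega>, \<lambda>j. V j \<omega>') \<partial>P) = ennreal (?e ^ N \<omega>)"
        by (simp add: one e ennreal_power)
    qed
  qed
  also have "\<dots> = ennreal (exp (total_mass * (?e - 1)))"
    using e by (intro poisson_pgf[OF N_measurable N_law]) auto
  finally show ?thesis .
qed

abbreviation R :: "real \<Rightarrow> 'a \<Rightarrow> real" where
  "R \<equiv> random_sum \<mu> T V"

lemma random_sum_clock:
  assumes "\<omega> \<in> space P" "u \<ge> 1"
  shows "R u \<omega> = (\<Sum>j<N \<omega>. clock (u - V j \<omega>))"
proof -
  have "clock (u - V j \<omega>) = \<mu> (u - V j \<omega>)" for j
    using V_range[OF assms(1), of j] assms(2) by (simp add: clock_def max_def)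
  then show ?thesis
    by (simp add: random_sum_def N_def)
qed

lemma random_sum_measurable:
  assumes "u \<ge> 1"
  shows "R u \<in> borel_measurable P"
proof -
  have "(\<lambda>\<omega>. \<Sum>j<N \<omega>. clock (u - V j \<omega>)) \<in> borel_measurable P"
    by (rule measurable_compose_countable[where f = "\<lambda>k \<omega>. \<Sum>j<k. clock (u - V j \<omega>)"]) measurable
  then show ?thesis
    using random_sum_clock[OF _ assms] by (subst measurable_cong) auto
qed

lemma random_sum_nonneg: "\<omega> \<in> space P \<Longrightarrow> u \<ge> 1 \<Longrightarrow> 0 \<le> R u \<omega>"
  unfolding random_sum_clock by (intro sum_nonneg clock_nonneg)

lemma random_sum_le:
  assumes "\<omega> \<in> space P" "u \<ge> 1" shows "R u \<omega> \<le> clock u * real (N \<omega>)"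
proof -
  have "clock (u - V j \<omega>) \<le> clock u" for j
    using V_range[OF assms(1), of j] by (intro clock_mono) auto
  then have "(\<Sum>j<N \<omega>. clock (u - V j \<omega>)) \<le> (\<Sum>j<N \<omega>. clock u)"
    by (intro sum_mono)
  then show ?thesis
    unfolding random_sum_clock[OF assms] by (simp add: mult.commute)
qed

lemma random_sum_mono: "\<omega> \<in> space P \<Longrightarrow> u \<ge> 1 \<Longrightarrow> u \<le> w \<Longrightarrow> R u \<omega> \<le> R w \<omega>"
  by (subst (1 2) random_sum_clock) (auto intro!: sum_mono clock_mono)

text \<open>
  Both sides equal the exponential of the integral of \<open>cluster_pgf x y - 1\<close> with respect to
  \<open>\<Lambda>\<close> over the unit interval. On the left this value arises as the limit
  of the discretised sums, on the right from the Poisson number of independent factors.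
\<close>

lemma cluster_model_joint_pgf:
  assumes xy: "0 < x" "x < 1" "0 < y" "y < 1"
  shows "expectation (\<lambda>\<omega>. x powr cluster_model T L t \<omega> * y powr (cluster_model T L (t + s) \<omega> - cluster_model T L t \<omega>))
    = expectation (\<lambda>\<omega>. pgf_base x powr R t \<omega> * pgf_base y powr (R (t + s) \<omega> - R t \<omega>))"
proof -
  let ?g = "cluster_pgf x y"
  note [measurable] = cluster_pgf_measurable[OF xy]
  have [measurable]: "grid n \<in> measurable (count_space UNIV) borel" for n
    by simp
  have "(\<lambda>n. expectation (\<lambda>\<omega>. x powr grid_cluster_sum n t \<omega> * y powr (grid_cluster_sum n (t + s) \<omega> - grid_cluster_sum n t \<omega>)))
    \<longlonglongrightarrow> expectation (\<lambda>\<omega>. x powr cluster_model T L t \<omega> * y powr (cluster_model T L (t + s) \<omega> - cluster_model T L t \<omega>))"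
  proof (rule integral_dominated_convergence[where w = "\<lambda>_. 1"])
    show "AE \<omega> in P. norm (x powr grid_cluster_sum n t \<omega> * y powr (grid_cluster_sum n (t + s) \<omega> - grid_cluster_sum n t \<omega>)) \<le> 1" for n
      using AE_grid_cluster_sum_values by eventually_elim (use nats_pgf_le_1[OF xy] in simp)
    show "AE \<omega> in P. (\<lambda>n. x powr grid_cluster_sum n t \<omega> * y powr (grid_cluster_sum n (t + s) \<omega> - grid_cluster_sum n t \<omega>))
        \<longlonglongrightarrow> x powr cluster_model T L t \<omega> * y powr (cluster_model T L (t + s) \<omega> - cluster_model T L t \<omega>)"
      using xy by (intro AE_I2 tendsto_mult tendsto_powr tendsto_diff tendsto_const grid_cluster_sum_tendsto) auto
  qed auto
  moreover have "expectation (\<lambda>\<omega>. x powr grid_cluster_sum n t \<omega> * y powr (grid_cluster_sum n (t + s) \<omega> - grid_cluster_sum n t \<omega>))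
      = exp (total_mass * (expectation (\<lambda>\<omega>. ?g (grid n (cell n (V 0 \<omega>)))) - 1))" for n
    using cluster_pgf_range(1)[OF xy]
    by (subst integral_eq_nn_integral)
      (auto simp: grid_pgf_given_points[OF xy] grid_product_points[where h = "\<lambda>i. ?g (grid n i)"])
  moreover have "(\<lambda>n. exp (total_mass * (expectation (\<lambda>\<omega>. ?g (grid n (cell n (V 0 \<omega>)))) - 1)))
      \<longlonglongrightarrow> exp (total_mass * (expectation (\<lambda>\<omega>. ?g (V 0 \<omega>)) - 1))"
  proof (intro tendsto_intros integral_dominated_convergence[where w = "\<lambda>_. 1"])
    show "AE \<omega> in P. (\<lambda>n. ?g (grid n (cell n (V 0 \<omega>)))) \<longlonglongrightarrow> ?g (V 0 \<omega>)"
    proof (rule AE_I2)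
      fix \<omega>
      have "isCont ?g (V 0 \<omega>)"
        using cluster_pgf_continuous[OF xy] by (simp add: continuous_on_eq_continuous_at)
      then show "(\<lambda>n. ?g (grid n (cell n (V 0 \<omega>)))) \<longlonglongrightarrow> ?g (V 0 \<omega>)"
        by (rule isCont_tendsto_compose[OF _ grid_cell_tendsto])
    qed
    show "AE \<omega> in P. norm (?g (grid n (cell n (V 0 \<omega>)))) \<le> 1" for n
      using cluster_pgf_range[OF xy] by simp
  qed auto
  moreover have "expectation (\<lambda>\<omega>. pgf_base x powr R t \<omega> * pgf_base y powr (R (t + s) \<omega> - R t \<omega>))
      = exp (total_mass * (expectation (\<lambda>\<omega>. ?g (V 0 \<omega>)) - 1))"
  proof -
    have [measurable]: "R t \<in> borel_measurable P" "R (t + s) \<in> borel_measurable P"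
      using t s by (auto intro: random_sum_measurable)
    have base: "pgf_base x \<noteq> 0" "pgf_base y \<noteq> 0"
      using pgf_base_bounds(1)[OF p, of x] pgf_base_bounds(1)[OF p, of y] xy by auto
    have "(\<integral>\<^sup>+\<omega>. ennreal (pgf_base x powr R t \<omega> * pgf_base y powr (R (t + s) \<omega> - R t \<omega>)) \<partial>P)
        = (\<integral>\<^sup>+\<omega>. ennreal (\<Prod>j<N \<omega>. ?g (V j \<omega>)) \<partial>P)"
    proof (rule nn_integral_cong)
      fix \<omega> assume \<omega>: "\<omega> \<in> space P"
      have "R (t + s) \<omega> - R t \<omega> = (\<Sum>j<N \<omega>. clock (t + s - V j \<omega>) - clock (t - V j \<omega>))"
        using t s by (simp add: random_sum_clock[OF \<omega>] sum_subtractf)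
      then show "ennreal (pgf_base x powr R t \<omega> * pgf_base y powr (R (t + s) \<omega> - R t \<omega>))
          = ennreal (\<Prod>j<N \<omega>. ?g (V j \<omega>))"
        unfolding cluster_pgf_def random_sum_clock[OF \<omega> t] using base
        by (simp only: powr_sum prod.distrib not_False_eq_True)
    qed
    also have "\<dots> = ennreal (exp (total_mass * (expectation (\<lambda>\<omega>. ?g (V 0 \<omega>)) - 1)))"
      by (intro product_normalized_points cluster_pgf_measurable[OF xy] cluster_pgf_range[OF xy])
    finally show ?thesis
      by (subst integral_eq_nn_integral) auto
  qed
  ultimately show ?thesis
    by (simp add: LIMSEQ_unique)
qed

text \<open>
  Comparison of coefficients in \<open>cluster_model_joint_pgf\<close>: the joint law of the value at time \<open>t\<close>
  and the increment is a mixture, over the random parameters \<open>R t\<close> and \<open>R (t + s) - R t\<close>, of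
  laws of independent negative binomial variables.
\<close>

lemma cluster_model_joint_law:
  "expectation (\<lambda>\<omega>. (if cluster_model T L t \<omega> = real m then 1 else 0)
      * (if cluster_model T L (t + s) \<omega> - cluster_model T L t \<omega> = real l then 1 else 0))
    = expectation (\<lambda>\<omega>. nb_mass p (R t \<omega>) m * nb_mass p (R (t + s) \<omega> - R t \<omega>) l)"
proof (rule joint_weights_eq)
  have [measurable]: "R t \<in> borel_measurable P" "R (t + s) \<in> borel_measurable P"
    using t s by (auto intro: random_sum_measurable)
  show "weights_with_pgf (\<lambda>k \<omega>. if cluster_model T L t \<omega> = real k then 1 else 0)
      (\<lambda>x \<omega>. x powr cluster_model T L t \<omega>)"
    by (rule weights_with_pgf_indicator) (use AE_cluster_model_values in auto)
  show "weights_with_pgf (\<lambda>k \<omega>. if cluster_model T L (t + s) \<omega> - cluster_model T L t \<omega> = real k then 1 else 0)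
      (\<lambda>x \<omega>. x powr (cluster_model T L (t + s) \<omega> - cluster_model T L t \<omega>))"
    by (rule weights_with_pgf_indicator) (use AE_cluster_model_values in auto)
  show "weights_with_pgf (\<lambda>k \<omega>. nb_mass p (R t \<omega>) k) (\<lambda>x \<omega>. pgf_base x powr R t \<omega>)"
    by (rule weights_with_pgf_nb_mass) (use p t random_sum_nonneg in auto)
  show "weights_with_pgf (\<lambda>k \<omega>. nb_mass p (R (t + s) \<omega> - R t \<omega>) k)
      (\<lambda>x \<omega>. pgf_base x powr (R (t + s) \<omega> - R t \<omega>))"
    by (rule weights_with_pgf_nb_mass) (use p t s random_sum_mono in auto)
qed (rule cluster_model_joint_pgf)

section \<open>Conditional moments\<close>

abbreviation X :: "'a \<Rightarrow> real" where
  "X \<equiv> R t"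

abbreviation Y :: "'a \<Rightarrow> real" where
  "Y \<equiv> R (t + s)"

abbreviation increment :: "'a \<Rightarrow> real" where
  "increment \<equiv> (\<lambda>\<omega>. cluster_model T L (t + s) \<omega> - cluster_model T L t \<omega>)"

abbreviation dominated :: "('a \<Rightarrow> real) \<Rightarrow> bool" where
  "dominated \<equiv> exp_dominated P (\<lambda>\<omega>. real (N \<omega>))"

lemma dominated_integrable: "dominated W \<Longrightarrow> integrable P W"
  by (rule exp_dominated_integrable[OF _ N_exp_moment])

lemma XY_measurable [measurable]: "X \<in> borel_measurable P" "Y \<in> borel_measurable P"
  using t s by (auto intro: random_sum_measurable)

lemma XY_bounds:
  assumes "\<omega> \<in> space P"
  shows "0 \<le> X \<omega>" "X \<omega> \<le> Y \<omega>" "\<bar>X \<omega>\<bar> \<le> 0 + clock t * real (N \<omega>)"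
    "\<bar>Y \<omega>\<bar> \<le> 0 + clock (t + s) * real (N \<omega>)" "\<bar>Y \<omega> - X \<omega>\<bar> \<le> 0 + clock (t + s) * real (N \<omega>)"
    "\<bar>X \<omega> + real k\<bar> \<le> real k + clock t * real (N \<omega>)"
  using random_sum_nonneg[OF assms, of t] random_sum_mono[OF assms, of t "t + s"]
    random_sum_le[OF assms, of t] random_sum_le[OF assms, of "t + s"] t s by auto

lemma dominated_powr: "dominated (\<lambda>\<omega>. p powr (X \<omega> - real k))"
  by (rule exp_dominated_powr[OF _ XY_bounds(3)]) (use p in auto)

lemma dominated_pochhammer:
  assumes "m \<ge> 1" shows "dominated (\<lambda>\<omega>. pochhammer (X \<omega>) m)"
proof -
  have "dominated (\<lambda>\<omega>. falling_factorial (X \<omega> + real (m - 1)) m)"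
    by (rule exp_dominated_falling_factorial[OF _ XY_bounds(6)]) auto
  then show ?thesis
    unfolding pochhammer_eq_falling_factorial[OF assms] .
qed

lemma dominated_X: "dominated X" and dominated_Y: "dominated Y"
  and dominated_difference: "dominated (\<lambda>\<omega>. Y \<omega> - X \<omega>)"
proof -
  have "dominated (\<lambda>\<omega>. falling_factorial (X \<omega>) (Suc 0))"
    by (rule exp_dominated_falling_factorial[OF _ XY_bounds(3)]) auto
  then show "dominated X" by (simp add: falling_factorial_1)
  have "dominated (\<lambda>\<omega>. falling_factorial (Y \<omega>) (Suc 0))"
    by (rule exp_dominated_falling_factorial[OF _ XY_bounds(4)]) auto
  then show "dominated Y" by (simp add: falling_factorial_1)
  have "dominated (\<lambda>\<omega>. falling_factorial (Y \<omega> - X \<omega>) (Suc 0))"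
    by (rule exp_dominated_falling_factorial[OF _ XY_bounds(5)]) auto
  then show "dominated (\<lambda>\<omega>. Y \<omega> - X \<omega>)" by (simp add: falling_factorial_1)
qed

lemma dominated_add:
  assumes "dominated W" "dominated W'" shows "dominated (\<lambda>\<omega>. W \<omega> + W' \<omega>)"
proof -
  obtain C r C' r' where C: "\<And>\<omega>. \<omega> \<in> space P \<Longrightarrow> \<bar>W \<omega>\<bar> \<le> C * exp (r * real (N \<omega>))"
      "\<And>\<omega>. \<omega> \<in> space P \<Longrightarrow> \<bar>W' \<omega>\<bar> \<le> C' * exp (r' * real (N \<omega>))"
    using assms unfolding exp_dominated_def by blast
  have "\<bar>W \<omega> + W' \<omega>\<bar> \<le> (\<bar>C\<bar> + \<bar>C'\<bar>) * exp ((\<bar>r\<bar> + \<bar>r'\<bar>) * real (N \<omega>))" if "\<omega> \<in> space P" for \<omega>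
  proof -
    have "C * exp (r * real (N \<omega>)) \<le> \<bar>C\<bar> * exp ((\<bar>r\<bar> + \<bar>r'\<bar>) * real (N \<omega>))"
      by (intro mult_mono) (auto intro!: mult_right_mono)
    moreover have "C' * exp (r' * real (N \<omega>)) \<le> \<bar>C'\<bar> * exp ((\<bar>r\<bar> + \<bar>r'\<bar>) * real (N \<omega>))"
      by (intro mult_mono) (auto intro!: mult_right_mono)
    ultimately show ?thesis
      using C[OF that] abs_triangle_ineq[of "W \<omega>" "W' \<omega>"]
        distrib_right[of "\<bar>C\<bar>" "\<bar>C'\<bar>" "exp ((\<bar>r\<bar> + \<bar>r'\<bar>) * real (N \<omega>))"] by linarith
  qed
  moreover have "(\<lambda>\<omega>. W \<omega> + W' \<omega>) \<in> borel_measurable P"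
    using assms[THEN exp_dominated_measurable] by measurable
  ultimately show ?thesis
    unfolding exp_dominated_def by blast
qed

text \<open>
  To be used with \<open>g = 1\<close>, \<open>g x = x\<close> and \<open>g x = x\<^sup>2\<close>; then \<open>h r\<close> is the corresponding moment of the
  negative binomial law with parameter \<open>r\<close>.
\<close>

lemma restricted_moment:
  assumes m: "m \<ge> 1" and [measurable]: "g \<in> borel_measurable borel" and g: "\<And>l::nat. 0 \<le> g (real l)"
    and h: "\<And>r. (\<lambda>l. g (real l) * nb_mass p r l) sums h r" and dom: "dominated (\<lambda>\<omega>. h (Y \<omega> - X \<omega>))"
  defines "A \<equiv> {\<omega> \<in> space P. cluster_model T L t \<omega> = real m}"
  shows "integrable P (\<lambda>\<omega>. indicator A \<omega> * g (increment \<omega>))"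
    and "expectation (\<lambda>\<omega>. indicator A \<omega> * g (increment \<omega>))
      = (1 - p) ^ m / fact m * expectation (\<lambda>\<omega>. h (Y \<omega> - X \<omega>) * (pochhammer (X \<omega>) m * p powr X \<omega>))"
proof -
  let ?c = "\<lambda>\<omega>. if cluster_model T L t \<omega> = real m then 1 else (0::real)"
  have nb: "nb_mass p (X \<omega>) m * h (Y \<omega> - X \<omega>)
      = (1 - p) ^ m / fact m * (h (Y \<omega> - X \<omega>) * (pochhammer (X \<omega>) m * p powr X \<omega>))" for \<omega>
    by (simp add: nb_mass_pochhammer)
  have "integrable P (\<lambda>\<omega>. (1 - p) ^ m / fact m * (h (Y \<omega> - X \<omega>) * (pochhammer (X \<omega>) m * p powr X \<omega>)))"
    using dominated_powr[of 0]
    by (intro dominated_integrable exp_dominated_mult exp_dominated_const dom dominated_pochhammer m) simp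
  then have int: "integrable P (\<lambda>\<omega>. nb_mass p (X \<omega>) m * h (Y \<omega> - X \<omega>))"
    unfolding nb .
  note * = expectation_from_joint_weights[where c = ?c and W = increment and g = g and h = "\<lambda>\<omega>. h (Y \<omega> - X \<omega>)"
      and c' = "\<lambda>\<omega>. nb_mass p (X \<omega>) m" and d = "\<lambda>l \<omega>. nb_mass p (Y \<omega> - X \<omega>) l"]
  have prems: "AE \<omega> in P. increment \<omega> \<in> \<nat>"
    "\<And>\<omega>. \<omega> \<in> space P \<Longrightarrow> 0 \<le> nb_mass p (X \<omega>) m \<and> nb_mass p (X \<omega>) m \<le> 1"
    "\<And>l \<omega>. \<omega> \<in> space P \<Longrightarrow> 0 \<le> nb_mass p (Y \<omega> - X \<omega>) l \<and> nb_mass p (Y \<omega> - X \<omega>) l \<le> 1"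
    using AE_cluster_model_values XY_bounds p by (auto intro!: nb_mass_nonneg nb_mass_le_1)
  have meas: "?c \<in> borel_measurable P" "increment \<in> borel_measurable P"
    "(\<lambda>\<omega>. nb_mass p (X \<omega>) m) \<in> borel_measurable P" "\<And>l. (\<lambda>\<omega>. nb_mass p (Y \<omega> - X \<omega>) l) \<in> borel_measurable P"
    by measurable
  have moments: "integrable P (\<lambda>\<omega>. ?c \<omega> * g (increment \<omega>))"
    "expectation (\<lambda>\<omega>. ?c \<omega> * g (increment \<omega>)) = expectation (\<lambda>\<omega>. nb_mass p (X \<omega>) m * h (Y \<omega> - X \<omega>))"
    by (rule *; use meas prems g h int cluster_model_joint_law in \<open>simp add: assms(2)\<close>)+
  have c: "indicator A \<omega> * g (increment \<omega>) = ?c \<omega> * g (increment \<omega>)" if "\<omega> \<in> space P" for \<omega>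
    using that by (simp add: A_def)
  show "integrable P (\<lambda>\<omega>. indicator A \<omega> * g (increment \<omega>))"
    using moments(1) by (subst Bochner_Integration.integrable_cong[OF refl c]) auto
  have "expectation (\<lambda>\<omega>. indicator A \<omega> * g (increment \<omega>)) = expectation (\<lambda>\<omega>. nb_mass p (X \<omega>) m * h (Y \<omega> - X \<omega>))"
    using moments(2) by (subst Bochner_Integration.integral_cong[OF refl c]) auto
  then show "expectation (\<lambda>\<omega>. indicator A \<omega> * g (increment \<omega>))
      = (1 - p) ^ m / fact m * expectation (\<lambda>\<omega>. h (Y \<omega> - X \<omega>) * (pochhammer (X \<omega>) m * p powr X \<omega>))"
    unfolding nb by simp
qed

lemma partial_deriv_random_sums:
  "partial_deriv k l (gen_fun2 P X Y) p 1
    = expectation (\<lambda>\<omega>. falling_factorial (Y \<omega>) l * (falling_factorial (X \<omega>) k * p powr (X \<omega> - real k)))"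
  by (rule partial_deriv_gen_fun2[OF N_exp_moment _ XY_bounds(3) _ XY_bounds(4) p(1)]) auto

text \<open>
  Multiplying the generating function by \<open>z ^ (m - 1)\<close> shifts the exponent by \<open>m - 1\<close>, which turns
  the falling factorials produced by differentiation into the rising ones of the negative
  binomial law.
\<close>

lemma deriv_random_sum:
  assumes m: "m \<ge> 1"
  shows "p * (deriv ^^ m) (\<lambda>z. z ^ (m - 1) * gen_fun P X z) p
    = expectation (\<lambda>\<omega>. pochhammer (X \<omega>) m * p powr X \<omega>)"
proof -
  have "(deriv ^^ m) (\<lambda>z. z ^ (m - 1) * gen_fun P X z) p
      = expectation (\<lambda>\<omega>. 1 * (falling_factorial (X \<omega> + real (m - 1)) m * p powr (X \<omega> + real (m - 1) - real m)))"
  proof (rule higher_deriv_power_moment[OF N_exp_moment _ XY_bounds(6) exp_dominated_const])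
    fix z :: real assume "0 < z"
    then show "z ^ (m - 1) * gen_fun P X z = expectation (\<lambda>\<omega>. 1 * z powr (X \<omega> + real (m - 1)))"
      by (simp add: gen_fun_def powr_add powr_realpow mult.commute del: of_nat_diff)
  qed (use p in auto)
  also have "\<dots> = expectation (\<lambda>\<omega>. pochhammer (X \<omega>) m * p powr (X \<omega> - 1))"
  proof -
    have "X \<omega> + real (m - 1) - real m = X \<omega> - 1" for \<omega>
      using m by simp
    then show ?thesis
      by (simp only: pochhammer_eq_falling_factorial[OF m] mult_1)
  qed
  finally have "p * (deriv ^^ m) (\<lambda>z. z ^ (m - 1) * gen_fun P X z) p
      = expectation (\<lambda>\<omega>. p * (pochhammer (X \<omega>) m * p powr (X \<omega> - 1)))"
    by simp
  also have "(\<lambda>\<omega>. p * (pochhammer (X \<omega>) m * p powr (X \<omega> - 1))) = (\<lambda>\<omega>. pochhammer (X \<omega>) m * p powr X \<omega>)"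
    using p by (simp add: powr_diff)
  finally show ?thesis .
qed

context
  fixes j :: nat
begin

text \<open>The integrand of the derivative of order \<open>j\<close> in the first variable.\<close>

definition w :: "'a \<Rightarrow> real" where
  "w \<omega> = falling_factorial (X \<omega>) j * p powr (X \<omega> - real j)"

lemma w_integrable:
  "integrable P w" "integrable P (\<lambda>\<omega>. X \<omega> * w \<omega>)" "integrable P (\<lambda>\<omega>. Y \<omega> * w \<omega>)"
  "integrable P (\<lambda>\<omega>. X \<omega> * (X \<omega> * w \<omega>))" "integrable P (\<lambda>\<omega>. X \<omega> * (Y \<omega> * w \<omega>))"
  "integrable P (\<lambda>\<omega>. Y \<omega> * (Y \<omega> * w \<omega>))"
proof -
  have "dominated w"
    unfolding w_def by (intro exp_dominated_mult dominated_powr exp_dominated_falling_factorial[OF _ XY_bounds(3)]) auto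
  then show "integrable P w" "integrable P (\<lambda>\<omega>. X \<omega> * w \<omega>)" "integrable P (\<lambda>\<omega>. Y \<omega> * w \<omega>)"
    "integrable P (\<lambda>\<omega>. X \<omega> * (X \<omega> * w \<omega>))" "integrable P (\<lambda>\<omega>. X \<omega> * (Y \<omega> * w \<omega>))"
    "integrable P (\<lambda>\<omega>. Y \<omega> * (Y \<omega> * w \<omega>))"
    by (intro dominated_integrable exp_dominated_mult dominated_X dominated_Y; assumption)+
qed

lemma w_Suc:
  "p * (falling_factorial (X \<omega>) (j + 1) * p powr (X \<omega> - real (j + 1))) = X \<omega> * w \<omega> - real j * w \<omega>"
proof -
  have "p * p powr (X \<omega> - real (j + 1)) = p powr (X \<omega> - real j)"
    using p powr_diff[of p "X \<omega> - real j" 1] by (simp add: algebra_simps)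
  then have "p * (falling_factorial (X \<omega>) (j + 1) * p powr (X \<omega> - real (j + 1)))
      = falling_factorial (X \<omega>) (j + 1) * p powr (X \<omega> - real j)"
    by (metis mult.left_commute)
  then show ?thesis
    by (simp add: w_def falling_factorial_Suc algebra_simps)
qed

lemma w_Suc_Suc:
  "p\<^sup>2 * (falling_factorial (X \<omega>) (j + 2) * p powr (X \<omega> - real (j + 2)))
    = X \<omega> * (X \<omega> * w \<omega>) - (2 * real j + 1) * (X \<omega> * w \<omega>) + real j * (real j + 1) * w \<omega>"
proof -
  have "p\<^sup>2 * p powr (X \<omega> - real (j + 2)) = p powr (X \<omega> - real j)"
    using p powr_diff[of p "X \<omega> - real j" 2] by (simp add: algebra_simps)
  then have "p\<^sup>2 * (falling_factorial (X \<omega>) (j + 2) * p powr (X \<omega> - real (j + 2)))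
      = falling_factorial (X \<omega>) (j + 2) * p powr (X \<omega> - real j)"
    by (metis mult.left_commute)
  then show ?thesis
    by (simp add: w_def falling_factorial_Suc algebra_simps)
qed

lemma partial_derivs_moments:
  defines "GG \<equiv> (\<lambda>k l. partial_deriv k l (gen_fun2 P X Y) p 1)"
  shows "GG j 0 = expectation w" "GG j 1 = expectation (\<lambda>\<omega>. Y \<omega> * w \<omega>)"
    "GG j 2 = expectation (\<lambda>\<omega>. Y \<omega> * (Y \<omega> * w \<omega>)) - expectation (\<lambda>\<omega>. Y \<omega> * w \<omega>)"
    "p * GG (j + 1) 0 = expectation (\<lambda>\<omega>. X \<omega> * w \<omega>) - real j * expectation w"
    "p * GG (j + 1) 1 = expectation (\<lambda>\<omega>. X \<omega> * (Y \<omega> * w \<omega>)) - real j * expectation (\<lambda>\<omega>. Y \<omega> * w \<omega>)"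
    "p\<^sup>2 * GG (j + 2) 0 = expectation (\<lambda>\<omega>. X \<omega> * (X \<omega> * w \<omega>)) - (2 * real j + 1) * expectation (\<lambda>\<omega>. X \<omega> * w \<omega>)
      + real j * (real j + 1) * expectation w"
proof -
  note GG = GG_def partial_deriv_random_sums
  show "GG j 0 = expectation w" "GG j 1 = expectation (\<lambda>\<omega>. Y \<omega> * w \<omega>)"
    unfolding GG by (simp_all add: w_def[abs_def] falling_factorial_1)
  have "GG j 2 = expectation (\<lambda>\<omega>. Y \<omega> * (Y \<omega> * w \<omega>) - Y \<omega> * w \<omega>)"
    unfolding GG by (simp add: w_def falling_factorial_2 algebra_simps)
  then show "GG j 2 = expectation (\<lambda>\<omega>. Y \<omega> * (Y \<omega> * w \<omega>)) - expectation (\<lambda>\<omega>. Y \<omega> * w \<omega>)"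
    by (simp add: w_integrable)
  have "p * GG (j + 1) 0 = expectation (\<lambda>\<omega>. X \<omega> * w \<omega> - real j * w \<omega>)"
    unfolding GG w_Suc[symmetric] by simp
  then show "p * GG (j + 1) 0 = expectation (\<lambda>\<omega>. X \<omega> * w \<omega>) - real j * expectation w"
    by (simp add: w_integrable)
  have "p * GG (j + 1) 1
      = expectation (\<lambda>\<omega>. Y \<omega> * (p * (falling_factorial (X \<omega>) (j + 1) * p powr (X \<omega> - real (j + 1)))))"
    unfolding GG integral_mult_right_zero[symmetric]
    by (simp only: One_nat_def falling_factorial_1 mult.left_commute)
  also have "\<dots> = expectation (\<lambda>\<omega>. X \<omega> * (Y \<omega> * w \<omega>) - real j * (Y \<omega> * w \<omega>))"
    unfolding w_Suc by (simp add: algebra_simps)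
  finally show "p * GG (j + 1) 1 = expectation (\<lambda>\<omega>. X \<omega> * (Y \<omega> * w \<omega>)) - real j * expectation (\<lambda>\<omega>. Y \<omega> * w \<omega>)"
    by (simp add: w_integrable)
  have "p\<^sup>2 * GG (j + 2) 0
      = expectation (\<lambda>\<omega>. X \<omega> * (X \<omega> * w \<omega>) - (2 * real j + 1) * (X \<omega> * w \<omega>) + real j * (real j + 1) * w \<omega>)"
    unfolding GG w_Suc_Suc[symmetric] by simp
  then show "p\<^sup>2 * GG (j + 2) 0 = expectation (\<lambda>\<omega>. X \<omega> * (X \<omega> * w \<omega>))
      - (2 * real j + 1) * expectation (\<lambda>\<omega>. X \<omega> * w \<omega>) + real j * (real j + 1) * expectation w"
    by (simp add: w_integrable)
qed

lemma powr_w: "p powr X \<omega> * falling_factorial (X \<omega>) j = p ^ j * w \<omega>"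
  using p by (simp add: w_def powr_diff powr_realpow)

text \<open>
  \<open>(Y - X) * (q / p)\<close> is the mean of the negative binomial law with parameter \<open>Y - X\<close>. Raising the order in the first
  variable by one multiplies the integrand by \<open>X - j\<close>, and in the bracket the terms in \<open>j\<close> cancel.
\<close>

lemma bracket_mean:
  defines "GG \<equiv> (\<lambda>k l. partial_deriv k l (gen_fun2 P X Y) p 1)"
  assumes j: "j \<ge> 1" and q: "q = 1 - p"
  shows "- (p ^ (j - 1) * q) * (real j * GG j 0 + p * GG (j + 1) 0 - GG j 1)
    = expectation (\<lambda>\<omega>. (Y \<omega> - X \<omega>) * (q / p) * (falling_factorial (X \<omega>) j * p powr X \<omega>))"
proof -
  have "p ^ j = p * p ^ (j - 1)"
    using j by (cases j) auto
  then have "falling_factorial (X \<omega>) j * p powr X \<omega> = p * (p ^ (j - 1) * w \<omega>)" for \<omega>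
    using powr_w[of \<omega>] by (simp add: mult_ac)
  then have "(Y \<omega> - X \<omega>) * (q / p) * (falling_factorial (X \<omega>) j * p powr X \<omega>)
      = (p ^ (j - 1) * q) * (Y \<omega> * w \<omega> - X \<omega> * w \<omega>)" for \<omega>
    using p by (simp add: right_diff_distrib left_diff_distrib mult_ac)
  then show ?thesis
    unfolding GG_def partial_derivs_moments by (simp add: w_integrable right_diff_distrib)
qed

text \<open>
  The first factor of the integrand is the second moment of the same law: its variance
  \<open>(Y - X) * (q / p\<^sup>2)\<close> plus the square of its mean. The cancellation of the terms in \<open>j\<close> now also uses \<open>p + q = 1\<close>.
\<close>

lemma bracket_second_moment:
  defines "GG \<equiv> (\<lambda>k l. partial_deriv k l (gen_fun2 P X Y) p 1)"
  assumes q: "q = 1 - p"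
  shows "(p powi (int j - 2) * q) * (real j * (real j * q - 1) * GG j 0 + p * (2 * real j * q - p) * GG (j + 1) 0
      - (2 * real j * q - 1 - q) * GG j 1 + q * (p\<^sup>2 * GG (j + 2) 0 - 2 * p * GG (j + 1) 1 + GG j 2))
    = expectation (\<lambda>\<omega>. (q / p\<^sup>2 * ((Y \<omega> - X \<omega>) + q * (Y \<omega> - X \<omega>)\<^sup>2)) * (falling_factorial (X \<omega>) j * p powr X \<omega>))"
proof -
  have pj: "p powi (int j - 2) = p ^ j / p\<^sup>2"
    using p by (simp add: power_int_diff)
  have w: "falling_factorial (X \<omega>) j * p powr X \<omega> = p ^ j * w \<omega>" for \<omega>
    using powr_w[of \<omega>] by (simp add: mult.commute)
  have integrand: "(q / p\<^sup>2 * ((Y \<omega> - X \<omega>) + q * (Y \<omega> - X \<omega>)\<^sup>2)) * (falling_factorial (X \<omega>) j * p powr X \<omega>)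
      = (p powi (int j - 2) * q) * ((Y \<omega> * w \<omega> - X \<omega> * w \<omega>)
        + q * (Y \<omega> * (Y \<omega> * w \<omega>) - 2 * (X \<omega> * (Y \<omega> * w \<omega>)) + X \<omega> * (X \<omega> * w \<omega>)))" for \<omega>
    unfolding pj w by (simp add: power2_eq_square algebra_simps)
  have bracket: "J * (J * q - 1) * a + (2 * J * q - p) * (b - J * a) - (2 * J * q - 1 - q) * c
      + q * ((d - (2 * J + 1) * b + J * (J + 1) * a) - 2 * (e - J * c) + (f - c))
      = (c - b) + q * (f - 2 * e + d)" for J a b c d e f :: real
    unfolding q by (simp add: algebra_simps)
  have "(p powi (int j - 2) * q) * (real j * (real j * q - 1) * GG j 0 + p * (2 * real j * q - p) * GG (j + 1) 0
      - (2 * real j * q - 1 - q) * GG j 1 + q * (p\<^sup>2 * GG (j + 2) 0 - 2 * p * GG (j + 1) 1 + GG j 2))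
    = (p powi (int j - 2) * q) * (real j * (real j * q - 1) * GG j 0 + (2 * real j * q - p) * (p * GG (j + 1) 0)
      - (2 * real j * q - 1 - q) * GG j 1 + q * (p\<^sup>2 * GG (j + 2) 0 - 2 * (p * GG (j + 1) 1) + GG j 2))"
    by (simp add: mult_ac)
  also have "\<dots> = (p powi (int j - 2) * q) * ((expectation (\<lambda>\<omega>. Y \<omega> * w \<omega>) - expectation (\<lambda>\<omega>. X \<omega> * w \<omega>))
        + q * (expectation (\<lambda>\<omega>. Y \<omega> * (Y \<omega> * w \<omega>)) - 2 * expectation (\<lambda>\<omega>. X \<omega> * (Y \<omega> * w \<omega>))
          + expectation (\<lambda>\<omega>. X \<omega> * (X \<omega> * w \<omega>))))"
    unfolding GG_def partial_derivs_moments bracket ..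
  also have "\<dots> = expectation (\<lambda>\<omega>. (q / p\<^sup>2 * ((Y \<omega> - X \<omega>) + q * (Y \<omega> - X \<omega>)\<^sup>2)) * (falling_factorial (X \<omega>) j * p powr X \<omega>))"
    unfolding integrand by (simp add: w_integrable)
  finally show ?thesis .
qed

end

text \<open>Expanding the rising factorial into falling ones turns each moment into the finite sum of the formulas.\<close>

lemma expectation_pochhammer_expand:
  assumes m: "m \<ge> 1" and dom: "dominated H"
  shows "expectation (\<lambda>\<omega>. H \<omega> * (pochhammer (X \<omega>) m * p powr X \<omega>))
    = (\<Sum>k=0..m-1. real (m choose k) * (fact (m - 1) / fact (m - k - 1))
        * expectation (\<lambda>\<omega>. H \<omega> * (falling_factorial (X \<omega>) (m - k) * p powr X \<omega>)))"
proof -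
  have "integrable P (\<lambda>\<omega>. H \<omega> * (falling_factorial (X \<omega>) j * p powr X \<omega>))" for j
    using dominated_powr[of 0]
    by (intro dominated_integrable exp_dominated_mult dom exp_dominated_falling_factorial[OF _ XY_bounds(3)]) auto
  moreover have "H \<omega> * (pochhammer (X \<omega>) m * p powr X \<omega>)
      = (\<Sum>k=0..m-1. real (m choose k) * (fact (m - 1) / fact (m - k - 1))
        * (H \<omega> * (falling_factorial (X \<omega>) (m - k) * p powr X \<omega>)))" for \<omega>
    unfolding pochhammer_eq_sum_falling_factorial[OF m] sum_distrib_right sum_distrib_left
    by (intro sum.cong refl) (simp only: mult_ac)
  ultimately show ?thesis
    by (simp add: integral_sum)
qed

text \<open>
  Conditional moments are moments restricted to \<open>A\<close> divided by the probability of \<open>A\<close>, and by the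
  lemma \<open>deriv_random_sum\<close> this probability is \<open>p * D\<close> up to the factor \<open>q ^ m / fact m\<close>, which
  cancels in the quotients.
\<close>

lemma conditional_moments:
  fixes m :: nat and q :: real
  assumes m: "m \<ge> 1" and q: "q = 1 - p"
  defines "A \<equiv> {\<omega> \<in> space P. cluster_model T L t \<omega> = real m}"
    and "GG \<equiv> (\<lambda>k l. partial_deriv k l (gen_fun2 P X Y) p 1)"
    and "D \<equiv> (deriv ^^ m) (\<lambda>z. z ^ (m - 1) * gen_fun P X z) p"
    and "M_hat \<equiv> cond_expectation_on P increment {\<omega> \<in> space P. cluster_model T L t \<omega> = real m}"
  shows "M_hat = 1 / (p * D) *
           (\<Sum>k=0..m-1. real (m choose k) * (fact (m - 1) / fact (m - k - 1)) *
              (- (p ^ (m - k - 1) * q)) *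
              (real (m - k) * GG (m - k) 0 + p * GG (m - k + 1) 0 - GG (m - k) 1))" (is ?mean)
    and "cond_variance_on P increment A = - (M_hat\<^sup>2) + 1 / (p * D) *
           (\<Sum>k=0..m-1. real (m choose k) * (fact (m - 1) / fact (m - k - 1)) *
              (p powi (int m - int k - 2) * q) *
              (real (m - k) * (real (m - k) * q - 1) * GG (m - k) 0
               + p * (2 * real (m - k) * q - p) * GG (m - k + 1) 0
               - (2 * real (m - k) * q - 1 - q) * GG (m - k) 1
               + q * (p\<^sup>2 * GG (m - k + 2) 0 - 2 * p * GG (m - k + 1) 1 + GG (m - k) 2)))" (is ?var)
proof -
  define \<kappa> where "\<kappa> = (1 - p) ^ m / fact m"
  define S1 where "S1 = expectation (\<lambda>\<omega>. (Y \<omega> - X \<omega>) * (q / p) * (pochhammer (X \<omega>) m * p powr X \<omega>))"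
  define S2 where "S2 = expectation (\<lambda>\<omega>. (q / p\<^sup>2 * ((Y \<omega> - X \<omega>) + q * (Y \<omega> - X \<omega>)\<^sup>2)) * (pochhammer (X \<omega>) m * p powr X \<omega>))"
  have \<kappa>: "\<kappa> \<noteq> 0" using p by (simp add: \<kappa>_def)
  have [measurable]: "A \<in> sets P" unfolding A_def by measurable
  have dom1: "dominated (\<lambda>\<omega>. (Y \<omega> - X \<omega>) * (q / p))"
    by (intro exp_dominated_mult dominated_difference exp_dominated_const)
  have dom2: "dominated (\<lambda>\<omega>. q / p\<^sup>2 * ((Y \<omega> - X \<omega>) + q * (Y \<omega> - X \<omega>)\<^sup>2))"
    unfolding power2_eq_square
    by (intro exp_dominated_mult dominated_add dominated_difference exp_dominated_const)
  have mass: "prob A = \<kappa> * (p * D)"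
  proof -
    have "expectation (\<lambda>\<omega>. indicator A \<omega> * 1) = \<kappa> * expectation (\<lambda>\<omega>. 1 * (pochhammer (X \<omega>) m * p powr X \<omega>))"
      unfolding A_def \<kappa>_def
      by (rule restricted_moment(2)[OF m, where g = "\<lambda>_. 1" and h = "\<lambda>_. 1"])
        (use nb_mass_sums_1[OF p] exp_dominated_const in auto)
    then show ?thesis
      using deriv_random_sum[OF m] by (simp add: D_def)
  qed
  have first: "integrable P (\<lambda>\<omega>. indicator A \<omega> * increment \<omega>)"
    "expectation (\<lambda>\<omega>. indicator A \<omega> * increment \<omega>) = \<kappa> * S1"
    unfolding A_def \<kappa>_def S1_def
    by (rule restricted_moment[OF m, where g = "\<lambda>x. x" and h = "\<lambda>r. r * (q / p)"];
        (use nb_mass_mean[OF p] dom1 q in auto))+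
  have second: "integrable P (\<lambda>\<omega>. indicator A \<omega> * (increment \<omega>)\<^sup>2)"
    "expectation (\<lambda>\<omega>. indicator A \<omega> * (increment \<omega>)\<^sup>2) = \<kappa> * S2"
    unfolding A_def \<kappa>_def S2_def
    by (rule restricted_moment[OF m, where g = "\<lambda>x. x\<^sup>2" and h = "\<lambda>r. q / p\<^sup>2 * (r + q * r\<^sup>2)"];
        (use nb_mass_second_moment[OF p] dom2 q in auto))+
  have M_hat: "M_hat = S1 / (p * D)"
    using \<kappa> unfolding M_hat_def cond_expectation_on_def A_def[symmetric]
    by (subst integral_uniform_measure) (simp_all add: first mass)
  define d where "d = p * D"
  have var: "cond_variance_on P increment A = - (M_hat\<^sup>2) + S2 / (p * D)"
  proof -
    have "cond_variance_on P increment A = expectation (\<lambda>\<omega>. indicator A \<omega> * (increment \<omega> - M_hat)\<^sup>2) / prob A"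
      unfolding cond_variance_on_def M_hat_def A_def[symmetric] by (subst integral_uniform_measure) auto
    also have "expectation (\<lambda>\<omega>. indicator A \<omega> * (increment \<omega> - M_hat)\<^sup>2)
        = expectation (\<lambda>\<omega>. indicator A \<omega> * (increment \<omega>)\<^sup>2 - 2 * M_hat * (indicator A \<omega> * increment \<omega>)
          + M_hat\<^sup>2 * indicator A \<omega>)"
      by (intro Bochner_Integration.integral_cong refl) (simp add: power2_eq_square algebra_simps)
    also have "\<dots> = \<kappa> * S2 - 2 * M_hat * (\<kappa> * S1) + M_hat\<^sup>2 * prob A"
    proof -
      have linear: "expectation (\<lambda>\<omega>. f \<omega> - a * g \<omega> + b * h \<omega>) = expectation f - a * expectation g + b * expectation h"
        if "integrable P f" "integrable P g" "integrable P h" for f g h :: "'a \<Rightarrow> real" and a b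
        using that by simp
      have "integrable P (indicator A :: 'a \<Rightarrow> real)" "expectation (indicator A) = prob A"
        by (auto intro!: integrable_real_indicator simp: emeasure_eq_measure)
      then show ?thesis
        using linear[OF second(1) first(1), of "indicator A" "2 * M_hat" "M_hat\<^sup>2"]
        unfolding first(2) second(2) by simp
    qed
    finally have eq: "cond_variance_on P increment A
        = (\<kappa> * S2 - 2 * M_hat * (\<kappa> * S1) + M_hat\<^sup>2 * (\<kappa> * d)) / (\<kappa> * d)"
      by (simp add: mass d_def)
    show ?thesis
    \<comment> \<open>if \<open>A\<close> is a null set, both sides are 0 because division by 0 gives 0\<close>
    proof (cases "d = 0")
      case True
      then have "M_hat = 0" using M_hat by (simp add: d_def[symmetric])
      then show ?thesis unfolding eq d_def[symmetric] using True by simp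
    next
      case False
      then have S1: "S1 = M_hat * d" using M_hat by (simp add: d_def)
      show ?thesis
        using False \<kappa> unfolding eq S1 d_def[symmetric]
        by (simp add: power2_eq_square divide_simps) (simp add: algebra_simps)
    qed
  qed
  have j: "m - k \<ge> 1" if "k \<in> {0..m-1}" for k using that m by auto
  have S1: "S1 = (\<Sum>k=0..m-1. real (m choose k) * (fact (m - 1) / fact (m - k - 1)) *
              (- (p ^ (m - k - 1) * q)) *
              (real (m - k) * GG (m - k) 0 + p * GG (m - k + 1) 0 - GG (m - k) 1))"
    unfolding S1_def expectation_pochhammer_expand[OF m dom1] GG_def
  proof (rule sum.cong[OF refl])
    fix k assume k: "k \<in> {0..m-1}"
    show "real (m choose k) * (fact (m - 1) / fact (m - k - 1)) *
        expectation (\<lambda>\<omega>. (Y \<omega> - X \<omega>) * (q / p) * (falling_factorial (X \<omega>) (m - k) * p powr X \<omega>))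
      = real (m choose k) * (fact (m - 1) / fact (m - k - 1)) * (- (p ^ (m - k - 1) * q)) *
        (real (m - k) * partial_deriv (m - k) 0 (gen_fun2 P X Y) p 1
         + p * partial_deriv (m - k + 1) 0 (gen_fun2 P X Y) p 1 - partial_deriv (m - k) 1 (gen_fun2 P X Y) p 1)"
      unfolding bracket_mean[OF j[OF k] q, symmetric] by (simp only: mult.assoc)
  qed
  have S2: "S2 = (\<Sum>k=0..m-1. real (m choose k) * (fact (m - 1) / fact (m - k - 1)) *
              (p powi (int m - int k - 2) * q) *
              (real (m - k) * (real (m - k) * q - 1) * GG (m - k) 0
               + p * (2 * real (m - k) * q - p) * GG (m - k + 1) 0
               - (2 * real (m - k) * q - 1 - q) * GG (m - k) 1
               + q * (p\<^sup>2 * GG (m - k + 2) 0 - 2 * p * GG (m - k + 1) 1 + GG (m - k) 2)))"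
    unfolding S2_def expectation_pochhammer_expand[OF m dom2] GG_def
  proof (rule sum.cong[OF refl])
    fix k assume "k \<in> {0..m-1}"
    then have k: "int m - int k - 2 = int (m - k) - 2" using m by auto
    show "real (m choose k) * (fact (m - 1) / fact (m - k - 1)) *
        expectation (\<lambda>\<omega>. q / p\<^sup>2 * (Y \<omega> - X \<omega> + q * (Y \<omega> - X \<omega>)\<^sup>2) * (falling_factorial (X \<omega>) (m - k) * p powr X \<omega>))
      = real (m choose k) * (fact (m - 1) / fact (m - k - 1)) * (p powi (int m - int k - 2) * q) *
        (real (m - k) * (real (m - k) * q - 1) * partial_deriv (m - k) 0 (gen_fun2 P X Y) p 1
         + p * (2 * real (m - k) * q - p) * partial_deriv (m - k + 1) 0 (gen_fun2 P X Y) p 1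
         - (2 * real (m - k) * q - 1 - q) * partial_deriv (m - k) 1 (gen_fun2 P X Y) p 1
         + q * (p\<^sup>2 * partial_deriv (m - k + 2) 0 (gen_fun2 P X Y) p 1
           - 2 * p * partial_deriv (m - k + 1) 1 (gen_fun2 P X Y) p 1 + partial_deriv (m - k) 2 (gen_fun2 P X Y) p 1))"
      unfolding k bracket_second_moment[OF q, symmetric] by (simp only: mult.assoc)
  qed
  show ?mean using M_hat S1 by simp
  show ?var using var S2 by simp
qed

end

theorem theorem2p7:
  fixes P :: "'a measure" and \<Lambda> :: "real measure"
    and T :: "nat \<Rightarrow> 'a \<Rightarrow> ereal" and L :: "nat \<Rightarrow> real \<Rightarrow> 'a \<Rightarrow> real"
    and V :: "nat \<Rightarrow> 'a \<Rightarrow> real" and \<mu> :: "real \<Rightarrow> real"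
    and p q s t :: real and m :: nat
    and M R :: "real \<Rightarrow> 'a \<Rightarrow> real" and M_incr :: "'a \<Rightarrow> real" and A :: "'a set"
    and G :: "real \<Rightarrow> real" and GG :: "nat \<Rightarrow> nat \<Rightarrow> real"
    and D M_hat :: real
  assumes "prob_space P"
    and "locally_finite_measure \<Lambda>" and "measure \<Lambda> {0..1} > 0"
    and "poisson_process P \<Lambda> T"
    and "continuous_on {0..} \<mu>" and "mono_on {0..} \<mu>" and "\<mu> 0 = 0" and "\<forall>u>0. \<mu> u > 0"
    and "0 < p" and "p < 1" and "q = 1 - p"
    and "iid_NB_clusters P \<mu> p L"
    and "indep_elements P
           (PiM UNIV (\<lambda>_. borel)) (\<lambda>\<omega> j. T j \<omega>)
           (PiM UNIV (\<lambda>_. PiM UNIV (\<lambda>_. borel))) (\<lambda>\<omega> j u. L j u \<omega>)"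
    and "iid_normalized P \<Lambda> V"
    and "indep_elements P
           (PiM UNIV (\<lambda>_. borel)) (\<lambda>\<omega> j. T j \<omega>) (PiM UNIV (\<lambda>_. borel)) (\<lambda>\<omega> j. V j \<omega>)"
    and "t \<ge> 1" and "s > 0" and "m \<ge> 1"
  defines "M \<equiv> cluster_model T L"
    and "R \<equiv> random_sum \<mu> T V"
    and "M_incr \<equiv> (\<lambda>\<omega>. M (t + s) \<omega> - M t \<omega>)"
    and "A \<equiv> {\<omega> \<in> space P. M t \<omega> = real m}"
    and "G \<equiv> gen_fun P (R t)"
    and "GG \<equiv> (\<lambda>k l. partial_deriv k l (gen_fun2 P (R t) (R (t + s))) p 1)"
    and "D \<equiv> (deriv ^^ m) (\<lambda>z. z ^ (m - 1) * G z) p"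
    and "M_hat \<equiv> cond_expectation_on P M_incr A"
  shows "M_hat = 1 / (p * D) *
           (\<Sum>k=0..m-1. real (m choose k) * (fact (m - 1) / fact (m - k - 1)) *
              (- (p ^ (m - k - 1) * q)) *
              (real (m - k) * GG (m - k) 0 + p * GG (m - k + 1) 0 - GG (m - k) 1))
    \<and> cond_variance_on P M_incr A = - (M_hat\<^sup>2) + 1 / (p * D) *
           (\<Sum>k=0..m-1. real (m choose k) * (fact (m - 1) / fact (m - k - 1)) *
              (p powi (int m - int k - 2) * q) *
              (real (m - k) * (real (m - k) * q - 1) * GG (m - k) 0
               + p * (2 * real (m - k) * q - p) * GG (m - k + 1) 0
               - (2 * real (m - k) * q - 1 - q) * GG (m - k) 1
               + q * (p\<^sup>2 * GG (m - k + 2) 0 - 2 * p * GG (m - k + 1) 1 + GG (m - k) 2)))"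
proof -
  interpret nb_cluster_model P \<Lambda> T L V \<mu> p s t
    by (intro nb_cluster_model.intro nb_cluster_model_axioms.intro) fact+
  show ?thesis
    unfolding M_hat_def A_def M_incr_def D_def G_def GG_def R_def M_def
    using conditional_moments[OF \<open>m \<ge> 1\<close> \<open>q = 1 - p\<close>] by blast
qed

end
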